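(* Let $D_x,D_y:V\to V$ be the two-block difference operators $D_x=H^{-1}E_y^TH^{(+)}D_x^{(+)}E_y$ and $D_y=H^{-1}E_y^TH^{(+)}D_y^{(+)}E_y$ for two blocks joined in the $y$-direction, and let $H_1\in\mathbb{R}^{(N_1+1)\times(N_1+1)}$ be symmetric positive definite. Then (i) $D_x,D_y$ satisfy summation by parts with respect to the inner product $(u,v)=u^THv$, i.e. for all $u,v\in V$ $$(u,D_xv)=\langle u,v\rangle_2-\langle u,v\rangle_4-(D_xu,v),\qquad (u,D_yv)=\langle u,v\rangle_3-\langle u,v\rangle_1-(D_yu,v),$$ if and only if $H_1^{(1)}=H_1^{(2)}=H_1$. (ii) $D_x,D_y$ are consistent approximations of $\partial/\partial x$ and $\partial/\partial y$. (iii) $D_x=E_y^+D_x^{(+)}E_y$ and $D_y=E_y^+D_y^{(+)}E_y$.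
   Context: $\Omega_1=[0,1]\times[0,1/2]$, $\Omega_2=[0,1]\times[1/2,1]$ have uniform grids with $(N_1+1)(N_2^{(k)}+1)$ points, $k=1,2$, with mesh sizes $h_1=1/N_1$ in $x$ and $h_2^{(k)}=1/(2N_2^{(k)})$ in $y$ (grid lines match at $y=1/2$). Put $N_2=N_2^{(1)}+N_2^{(2)}$. Grid vectors are row-ordered ($x$-index inner, $y$-index outer). On block $k$: $H^{(k)}=H_2^{(k)}\otimes H_1^{(k)}$, $D_x^{(k)}=I_2^{(k)}\otimes D_1^{(k)}$, $D_y^{(k)}=D_2^{(k)}\otimes I_1$, where $H_1^{(k)}\in\mathbb{R}^{(N_1+1)\times(N_1+1)}$, $H_2^{(k)}\in\mathbb{R}^{(N_2^{(k)}+1)\times(N_2^{(k)}+1)}$ are symmetric positive definite, $I_1,I_2^{(k)}$ are identities, and $D_l^{(k)}$ is a one-dimensional consistent difference operator satisfying summation by parts with respect to $H_l^{(k)}$: $a^THDb=a_Mb_M-a_0b_0-(Da)^THb$ for all vectors $a=(a_0,\dots,a_M)^T$, $b$ (with $H=H_l^{(k)}$, $D=D_l^{(k)}$). $H^{(+)}=\mathrm{diag}(H^{(1)},H^{(2)})$, $D_x^{(+)}=\mathrm{diag}(D_x^{(1)},D_x^{(2)})$, $D_y^{(+)}=\mathrm{diag}(D_y^{(1)},D_y^{(2)})$; $V_+$ is the space of pairs $(u^{(1)};u^{(2)})$ with inner product given by $H^{(+)}$. $E_2^{(1)}\in\mathbb{R}^{(N_2^{(1)}+1)\times(N_2+1)}$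 and $E_2^{(2)}\in\mathbb{R}^{(N_2^{(2)}+1)\times(N_2+1)}$ extract the components with indices $0,\dots,N_2^{(1)}$ and $N_2^{(1)},\dots,N_2$ respectively; $E_y^{(k)}=E_2^{(k)}\otimes I_1$ and $E_y=(E_y^{(1)};E_y^{(2)})$ (stacked). $V=\mathbb{R}^{(N_1+1)(N_2+1)}$ has inner product $(u,v)=u^THv$ with $H=E_y^TH^{(+)}E_y$. $E_y^+$ is the Moore–Penrose pseudoinverse of $E_y:V\to V_+$ with respect to these inner products ($E_yE_y^+E_y=E_y$, $E_y^+E_yE_y^+=E_y^+$, $E_y^+E_y$ and $E_yE_y^+$ self-adjoint). For $u=(u_{ij})\in V$, $0\le i\le N_1$, $0\le j\le N_2$, let $u_j=(u_{0j},\dots,u_{N_1j})^T$ and $u^i=(u_{i0},\dots,u_{iN_2})^T$. Let $H_2=[E_2^{(1)}]^TH_2^{(1)}E_2^{(1)}+[E_2^{(2)}]^TH_2^{(2)}E_2^{(2)}$. Boundary products: $\langle u,v\rangle_1=u_0^TH_1v_0$, $\langle u,v\rangle_2=[u^{N_1}]^TH_2v^{N_1}$, $\langle u,v\rangle_3=u_{N_2}^TH_1v_{N_2}$, $\langle u,v\rangle_4=[u^0]^TH_2v^0$. Consistency: the block operators are assumed consistent of some order $p>0$, meaning that for each smooth $u$, with superscript $(k)$ denoting restriction to the grid of block $k$, $D_x^{(k)}u^{(k)}=u_x^{(k)}+\mathcal{O}(h^p)$ and $D_y^{(k)}u^{(k)}=u_y^{(k)}+\mathcal{O}(h^p)$ as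 the maximal mesh size $h\to0$; consistency of $D_x,D_y$ means $D_xu=u_x+\mathcal{O}(h^p)$, $D_yu=u_y+\mathcal{O}(h^p)$ for grid restrictions to $\Omega_1\cup\Omega_2$. The $\mathcal{O}(h^p)$ terms are measured in the norms induced by the inner products of the respective spaces. *)

theory Defs
  imports
    "HOL-Analysis.Derivative"
    "HOL-Library.Landau_Symbols"
    "Jordan_Normal_Form.Gauss_Jordan_Elimination"
begin

unbundle no vec_syntax and no inner_syntax
hide_const (open) Finite_Cartesian_Product.vec Finite_Cartesian_Product.mat
  Finite_Cartesian_Product.row
hide_type (open) Finite_Cartesian_Product.vec

definition kron :: "real mat \<Rightarrow> real mat \<Rightarrow> real mat" where
  "kron A B = mat (dim_row A * dim_row B) (dim_col A * dim_col B)
     (\<lambda>(r, c). A $$ (r div dim_row B, c div dim_col B) * B $$ (r mod dim_row B, c mod dim_col B))"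

definition sym_pos_def :: "nat \<Rightarrow> real mat \<Rightarrow> bool" where
  "sym_pos_def n A \<longleftrightarrow> A \<in> carrier_mat n n \<and> transpose_mat A = A \<and>
     (\<forall>x \<in> carrier_vec n. x \<noteq> 0\<^sub>v n \<longrightarrow> x \<bullet> (A *\<^sub>v x) > 0)"

definition mat_inv :: "real mat \<Rightarrow> real mat" where
  "mat_inv A = the (mat_inverse A)"

definition ip :: "real mat \<Rightarrow> real vec \<Rightarrow> real vec \<Rightarrow> real" where
  "ip G u v = u \<bullet> (G *\<^sub>v v)"

definition ip_norm :: "real mat \<Rightarrow> real vec \<Rightarrow> real" where
  "ip_norm G u = sqrt (ip G u u)"

text \<open>\<open>P\<close> is the Moore--Penrose pseudoinverse of \<open>A\<close>, regarded as a map from \<open>\<real>\<^sup>n\<close> with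
  inner product \<open>ip G\<close> to \<open>\<real>\<^sup>m\<close> with inner product \<open>ip K\<close>.\<close>

definition is_mp_inverse :: "real mat \<Rightarrow> real mat \<Rightarrow> real mat \<Rightarrow> real mat \<Rightarrow> bool" where
  "is_mp_inverse G K A P \<longleftrightarrow>
     P \<in> carrier_mat (dim_col A) (dim_row A) \<and>
     A * P * A = A \<and> P * A * P = P \<and>
     (\<forall>u \<in> carrier_vec (dim_col A). \<forall>v \<in> carrier_vec (dim_col A).
        ip G u ((P * A) *\<^sub>v v) = ip G ((P * A) *\<^sub>v u) v) \<and>
     (\<forall>u \<in> carrier_vec (dim_row A). \<forall>v \<in> carrier_vec (dim_row A).
        ip K u ((A * P) *\<^sub>v v) = ip K ((A * P) *\<^sub>v u) v)"

definition mp_inverse :: "real mat \<Rightarrow> real mat \<Rightarrow> real mat \<Rightarrow> real mat" where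
  "mp_inverse G K A = (THE P. is_mp_inverse G K A P)"

definition sbp_1d :: "nat \<Rightarrow> real mat \<Rightarrow> real mat \<Rightarrow> bool" where
  "sbp_1d M H D \<longleftrightarrow> D \<in> carrier_mat (M + 1) (M + 1) \<and>
     (\<forall>a \<in> carrier_vec (M + 1). \<forall>b \<in> carrier_vec (M + 1).
        ip H a (D *\<^sub>v b) = a $ M * b $ M - a $ 0 * b $ 0 - ip H (D *\<^sub>v a) b)"


text \<open>The one-dimensional data of a two-block discretisation. The fields other than \<open>Nx\<close> are
  families indexed by the block number, of which only the values at 1 and 2 are meaningful.\<close>

record two_block =
  Nx :: nat                       \<comment> \<open>\<open>N\<^sub>1\<close>\<close>
  Ny :: "nat \<Rightarrow> nat"             \<comment> \<open>\<open>N\<^sub>2\<^sup>(\<^sup>k\<^sup>)\<close>\<close>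
  normx :: "nat \<Rightarrow> real mat"     \<comment> \<open>\<open>H\<^sub>1\<^sup>(\<^sup>k\<^sup>)\<close>\<close>
  normy :: "nat \<Rightarrow> real mat"     \<comment> \<open>\<open>H\<^sub>2\<^sup>(\<^sup>k\<^sup>)\<close>\<close>
  diffx :: "nat \<Rightarrow> real mat"     \<comment> \<open>\<open>D\<^sub>1\<^sup>(\<^sup>k\<^sup>)\<close>\<close>
  diffy :: "nat \<Rightarrow> real mat"     \<comment> \<open>\<open>D\<^sub>2\<^sup>(\<^sup>k\<^sup>)\<close>\<close>

definition valid_two_block :: "two_block \<Rightarrow> bool" where
  "valid_two_block S \<longleftrightarrow> Nx S \<ge> 1 \<and>
     (\<forall>k \<in> {1, 2}. Ny S k \<ge> 1 \<and>
        sym_pos_def (Nx S + 1) (normx S k) \<and> sym_pos_def (Ny S k + 1) (normy S k) \<and>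
        sbp_1d (Nx S) (normx S k) (diffx S k) \<and> sbp_1d (Ny S k) (normy S k) (diffy S k))"

definition Ny_tot :: "two_block \<Rightarrow> nat" where
  "Ny_tot S = Ny S 1 + Ny S 2"

definition dimV :: "two_block \<Rightarrow> nat" where
  "dimV S = (Nx S + 1) * (Ny_tot S + 1)"

definition H_blk :: "two_block \<Rightarrow> nat \<Rightarrow> real mat" where
  "H_blk S k = kron (normy S k) (normx S k)"

definition Dx_blk :: "two_block \<Rightarrow> nat \<Rightarrow> real mat" where
  "Dx_blk S k = kron (1\<^sub>m (Ny S k + 1)) (diffx S k)"

definition Dy_blk :: "two_block \<Rightarrow> nat \<Rightarrow> real mat" where
  "Dy_blk S k = kron (diffy S k) (1\<^sub>m (Nx S + 1))"

definition H_plus :: "two_block \<Rightarrow> real mat" where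
  "H_plus S = diag_block_mat [H_blk S 1, H_blk S 2]"

definition Dx_plus :: "two_block \<Rightarrow> real mat" where
  "Dx_plus S = diag_block_mat [Dx_blk S 1, Dx_blk S 2]"

definition Dy_plus :: "two_block \<Rightarrow> real mat" where
  "Dy_plus S = diag_block_mat [Dy_blk S 1, Dy_blk S 2]"

definition E2 :: "two_block \<Rightarrow> nat \<Rightarrow> real mat" where
  "E2 S k = mat (Ny S k + 1) (Ny_tot S + 1)
     (\<lambda>(r, c). if c = (if k = 1 then 0 else Ny S 1) + r then 1 else 0)"

definition Ey :: "two_block \<Rightarrow> real mat" where
  "Ey S = kron (E2 S 1) (1\<^sub>m (Nx S + 1)) @\<^sub>r kron (E2 S 2) (1\<^sub>m (Nx S + 1))"

definition H_mat :: "two_block \<Rightarrow> real mat" where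
  "H_mat S = transpose_mat (Ey S) * H_plus S * Ey S"

definition Dx :: "two_block \<Rightarrow> real mat" where
  "Dx S = mat_inv (H_mat S) * transpose_mat (Ey S) * H_plus S * Dx_plus S * Ey S"

definition Dy :: "two_block \<Rightarrow> real mat" where
  "Dy S = mat_inv (H_mat S) * transpose_mat (Ey S) * H_plus S * Dy_plus S * Ey S"

definition Ey_pinv :: "two_block \<Rightarrow> real mat" where
  "Ey_pinv S = mp_inverse (H_mat S) (H_plus S) (Ey S)"


text \<open>In row ordering the grid component \<open>u\<^sub>i\<^sub>j\<close> has index \<open>j (N\<^sub>1 + 1) + i\<close>;
  \<open>grid_row S u j\<close> is \<open>u\<^sub>j\<close> and \<open>grid_col S u i\<close> is \<open>u\<^sup>i\<close>.\<close>

definition grid_row :: "two_block \<Rightarrow> real vec \<Rightarrow> nat \<Rightarrow> real vec" where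
  "grid_row S u j = vec (Nx S + 1) (\<lambda>i. u $ (j * (Nx S + 1) + i))"

definition grid_col :: "two_block \<Rightarrow> real vec \<Rightarrow> nat \<Rightarrow> real vec" where
  "grid_col S u i = vec (Ny_tot S + 1) (\<lambda>j. u $ (j * (Nx S + 1) + i))"

definition H2_mat :: "two_block \<Rightarrow> real mat" where
  "H2_mat S = transpose_mat (E2 S 1) * normy S 1 * E2 S 1 + transpose_mat (E2 S 2) * normy S 2 * E2 S 2"

definition bprod1 :: "two_block \<Rightarrow> real mat \<Rightarrow> real vec \<Rightarrow> real vec \<Rightarrow> real" where
  "bprod1 S H1 u v = ip H1 (grid_row S u 0) (grid_row S v 0)"

definition bprod2 :: "two_block \<Rightarrow> real vec \<Rightarrow> real vec \<Rightarrow> real" where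
  "bprod2 S u v = ip (H2_mat S) (grid_col S u (Nx S)) (grid_col S v (Nx S))"

definition bprod3 :: "two_block \<Rightarrow> real mat \<Rightarrow> real vec \<Rightarrow> real vec \<Rightarrow> real" where
  "bprod3 S H1 u v = ip H1 (grid_row S u (Ny_tot S)) (grid_row S v (Ny_tot S))"

definition bprod4 :: "two_block \<Rightarrow> real vec \<Rightarrow> real vec \<Rightarrow> real" where
  "bprod4 S u v = ip (H2_mat S) (grid_col S u 0) (grid_col S v 0)"

definition sbp_2d :: "two_block \<Rightarrow> real mat \<Rightarrow> bool" where
  "sbp_2d S H1 \<longleftrightarrow> (\<forall>u \<in> carrier_vec (dimV S). \<forall>v \<in> carrier_vec (dimV S).
     ip (H_mat S) u (Dx S *\<^sub>v v) = bprod2 S u v - bprod4 S u v - ip (H_mat S) (Dx S *\<^sub>v u) v \<and>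
     ip (H_mat S) u (Dy S *\<^sub>v v) = bprod3 S H1 u v - bprod1 S H1 u v - ip (H_mat S) (Dy S *\<^sub>v u) v)"


text \<open>Smoothness on the closed square \<open>[0,1] \<times> [0,1]\<close>: all iterated partial derivatives
  exist (one-sided at the boundary) and are continuous up to the boundary; \<open>g m n\<close> is the
  derivative of order \<open>m\<close> in the first and \<open>n\<close> in the second variable.\<close>

definition smooth_square :: "(real \<Rightarrow> real \<Rightarrow> real) \<Rightarrow> bool" where
  "smooth_square u \<longleftrightarrow> (\<exists>g :: nat \<Rightarrow> nat \<Rightarrow> real \<Rightarrow> real \<Rightarrow> real.
     (\<forall>x \<in> {0..1}. \<forall>y \<in> {0..1}. g 0 0 x y = u x y) \<and>
     (\<forall>m n. continuous_on ({0..1} \<times> {0..1}) (\<lambda>(x, y). g m n x y)) \<and>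
     (\<forall>m n. \<forall>x \<in> {0..1}. \<forall>y \<in> {0..1}.
        ((\<lambda>t. g m n t y) has_real_derivative g (Suc m) n x y) (at x within {0..1}) \<and>
        ((\<lambda>t. g m n x t) has_real_derivative g m (Suc n) x y) (at y within {0..1})))"

definition partial_x :: "(real \<Rightarrow> real \<Rightarrow> real) \<Rightarrow> real \<Rightarrow> real \<Rightarrow> real" where
  "partial_x u x y = vector_derivative (\<lambda>t. u t y) (at x within {0..1})"

definition partial_y :: "(real \<Rightarrow> real \<Rightarrow> real) \<Rightarrow> real \<Rightarrow> real \<Rightarrow> real" where
  "partial_y u x y = vector_derivative (\<lambda>t. u x t) (at y within {0..1})"

definition hx :: "two_block \<Rightarrow> real" where
  "hx S = 1 / real (Nx S)"

definition hy :: "two_block \<Rightarrow> nat \<Rightarrow> real" where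
  "hy S k = 1 / (2 * real (Ny S k))"

definition mesh :: "two_block \<Rightarrow> real" where
  "mesh S = Max {hx S, hy S 1, hy S 2}"

definition y_blk :: "two_block \<Rightarrow> nat \<Rightarrow> nat \<Rightarrow> real" where
  "y_blk S k j = (if k = 1 then 0 else 1 / 2) + real j * hy S k"

definition y_full :: "two_block \<Rightarrow> nat \<Rightarrow> real" where
  "y_full S j = (if j \<le> Ny S 1 then y_blk S 1 j else y_blk S 2 (j - Ny S 1))"

definition restr_blk :: "two_block \<Rightarrow> nat \<Rightarrow> (real \<Rightarrow> real \<Rightarrow> real) \<Rightarrow> real vec" where
  "restr_blk S k u = vec ((Nx S + 1) * (Ny S k + 1))
     (\<lambda>m. u (real (m mod (Nx S + 1)) * hx S) (y_blk S k (m div (Nx S + 1))))"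

definition restr :: "two_block \<Rightarrow> (real \<Rightarrow> real \<Rightarrow> real) \<Rightarrow> real vec" where
  "restr S u = vec (dimV S)
     (\<lambda>m. u (real (m mod (Nx S + 1)) * hx S) (y_full S (m div (Nx S + 1))))"

text \<open>Consistency concerns a family \<open>S\<close> of discretisations, with an arbitrary index type, as the
  maximal mesh size tends to \<open>0\<close> along the family.\<close>

definition mesh_to_0 :: "('i \<Rightarrow> two_block) \<Rightarrow> 'i filter" where
  "mesh_to_0 S = filtercomap (\<lambda>i. mesh (S i)) (at_right 0)"

definition blocks_consistent :: "real \<Rightarrow> ('i \<Rightarrow> two_block) \<Rightarrow> bool" where
  "blocks_consistent p S \<longleftrightarrow> (\<forall>u. smooth_square u \<longrightarrow> (\<forall>k \<in> {1, 2}.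
     (\<lambda>i. ip_norm (H_blk (S i) k)
        (Dx_blk (S i) k *\<^sub>v restr_blk (S i) k u - restr_blk (S i) k (partial_x u)))
       \<in> O[mesh_to_0 S](\<lambda>i. mesh (S i) powr p) \<and>
     (\<lambda>i. ip_norm (H_blk (S i) k)
        (Dy_blk (S i) k *\<^sub>v restr_blk (S i) k u - restr_blk (S i) k (partial_y u)))
       \<in> O[mesh_to_0 S](\<lambda>i. mesh (S i) powr p)))"

definition Dx_consistent :: "real \<Rightarrow> ('i \<Rightarrow> two_block) \<Rightarrow> bool" where
  "Dx_consistent p S \<longleftrightarrow> (\<forall>u. smooth_square u \<longrightarrow>
     (\<lambda>i. ip_norm (H_mat (S i)) (Dx (S i) *\<^sub>v restr (S i) u - restr (S i) (partial_x u)))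
       \<in> O[mesh_to_0 S](\<lambda>i. mesh (S i) powr p))"

definition Dy_consistent :: "real \<Rightarrow> ('i \<Rightarrow> two_block) \<Rightarrow> bool" where
  "Dy_consistent p S \<longleftrightarrow> (\<forall>u. smooth_square u \<longrightarrow>
     (\<lambda>i. ip_norm (H_mat (S i)) (Dy (S i) *\<^sub>v restr (S i) u - restr (S i) (partial_y u)))
       \<in> O[mesh_to_0 S](\<lambda>i. mesh (S i) powr p))"

end

theory Submission
  imports Defs "Jordan_Normal_Form.Determinant"
begin

text \<open>Everything rests on one observation: the matrix
  \<open>P = H\<^sup>-\<^sup>1 E\<^sub>y\<^sup>T H\<^sup>(\<^sup>+\<^sup>)\<close>, which turns a pair of block operators into an operator on the joined
  grid, is the least-squares left inverse of \<open>E\<^sub>y\<close>. It is characterised by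
  \<open>(u, P w) = (E\<^sub>y u, w)\<close> for all \<open>u\<close> and \<open>w\<close>, with the inner products of \<open>V\<close> and \<open>V\<^sub>+\<close> on the
  two sides (lemma \<open>ip_wpinv\<close>). Hence \<open>P E\<^sub>y = 1\<close> and \<open>E\<^sub>y P\<close> is the orthogonal projection onto
  the range of \<open>E\<^sub>y\<close>, so \<open>P\<close> is the Moore--Penrose inverse of \<open>E\<^sub>y\<close>; this is (iii). To have
  inner products at all one needs that the Kronecker product of positive definite matrices is
  positive definite (lemma \<open>sym_pos_def_kron\<close>).

  For (ii), the error of a joined operator at a grid function is \<open>P\<close> applied to the pair of
  block errors, because the true derivative, restricted to both blocks, lies in the range of
  \<open>E\<^sub>y\<close>. As \<open>P\<close> does not increase norms (lemma \<open>wpinv_contraction\<close>), the error is at most the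
  sum of the two block errors (lemma \<open>joined_error_bound\<close>).

  For (i), the characterisation of \<open>P\<close> gives \<open>(u, D\<^sub>x v) = (E\<^sub>y u, D\<^sub>x\<^sup>(\<^sup>+\<^sup>) E\<^sub>y v)\<close>, a sum of one term
  for each block, and likewise for \<open>D\<^sub>y\<close>. On one block the inner product is a combination, with the
  entries of \<open>H\<^sub>2\<close> as coefficients, of \<open>H\<^sub>1\<close>-products of grid rows, and \<open>D\<^sub>x\<close> acts on each row
  separately, so one-dimensional summation by parts can be applied to each pair of rows; for
  \<open>D\<^sub>y\<close> one uses columns instead. In the \<open>x\<close> direction the block boundary terms add up
  to those of the joined grid. In the \<open>y\<close> direction the first block contributes a product with
  weight \<open>H\<^sub>1\<^sup>(\<^sup>1\<^sup>)\<close> along \<open>y = 0\<close> and along the interface, and the second one a product with weight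
  \<open>H\<^sub>1\<^sup>(\<^sup>2\<^sup>)\<close> along the interface, with the opposite sign, and along \<open>y = 1\<close> (lemma \<open>sbp_Dy\<close>). If both
  weights equal \<open>H\<^sub>1\<close>, the interface terms cancel. Conversely, grid functions that are
  supported in the bottom or in the top row detect each of the two weights separately.\<close>

section \<open>Inner products given by matrices\<close>

lemma sum_rotate: "(\<Sum>j\<in>A. \<Sum>l\<in>B. \<Sum>k\<in>C. f j l k) = (\<Sum>k\<in>C. \<Sum>j\<in>A. \<Sum>l\<in>B. f j l k)"
  by (simp add: sum.swap[of _ _ C])

lemma ip_sum:
  assumes "G \<in> carrier_mat n n" "u \<in> carrier_vec n" "v \<in> carrier_vec n"
  shows "ip G u v = (\<Sum>i<n. \<Sum>j<n. G $$ (i, j) * (u $ i * v $ j))"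
  using assms
  by (auto simp: ip_def scalar_prod_def mult_mat_vec_def sum_distrib_left atLeast0LessThan
      intro!: sum.cong)

lemma ip_sum_left:
  assumes "G \<in> carrier_mat n n" "v \<in> carrier_vec n"
  shows "ip G (vec n (\<lambda>i. \<Sum>k\<in>K. c k * f k i)) v = (\<Sum>k\<in>K. c k * ip G (vec n (f k)) v)"
proof -
  have "ip G (vec n (\<lambda>i. \<Sum>k\<in>K. c k * f k i)) v
      = (\<Sum>i<n. \<Sum>j<n. \<Sum>k\<in>K. c k * (G $$ (i, j) * (f k i * v $ j)))"
    using assms
    by (simp add: ip_sum[of _ n] sum_distrib_left sum_distrib_right mult.left_commute mult.assoc)
  also have "\<dots> = (\<Sum>k\<in>K. \<Sum>i<n. \<Sum>j<n. c k * (G $$ (i, j) * (f k i * v $ j)))"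
    by (rule sum_rotate)
  also have "\<dots> = (\<Sum>k\<in>K. c k * ip G (vec n (f k)) v)"
    using assms by (simp add: ip_sum[of _ n] sum_distrib_left)
  finally show ?thesis .
qed

lemma ip_sym:
  assumes "sym_pos_def n G" "u \<in> carrier_vec n" "v \<in> carrier_vec n"
  shows "ip G u v = ip G v u"
proof -
  have G: "G \<in> carrier_mat n n" and t: "transpose_mat G = G"
    using assms(1) by (auto simp: sym_pos_def_def)
  have "ip G u v = (transpose_mat G *\<^sub>v u) \<bullet> v"
    using transpose_vec_mult_scalar[OF G assms(3,2)] by (simp add: ip_def)
  also have "\<dots> = ip G v u"
    using G assms(2,3) unfolding ip_def t by (intro comm_scalar_prod[of _ n]) auto
  finally show ?thesis .
qed

lemma ip_sum_right:
  assumes "sym_pos_def n G" "v \<in> carrier_vec n"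
  shows "ip G v (vec n (\<lambda>i. \<Sum>k\<in>K. c k * f k i)) = (\<Sum>k\<in>K. c k * ip G v (vec n (f k)))"
proof -
  have "G \<in> carrier_mat n n" using assms by (auto simp: sym_pos_def_def)
  then show ?thesis
    using ip_sum_left[where G = G and n = n and v = v and K = K and c = c and f = f] assms(2) by (simp add: ip_sym[OF assms(1) assms(2)])
qed

lemma ip_add_mat:
  assumes "A \<in> carrier_mat n n" "B \<in> carrier_mat n n" "u \<in> carrier_vec n" "v \<in> carrier_vec n"
  shows "ip (A + B) u v = ip A u v + ip B u v"
  using assms by (simp add: ip_sum[of _ n] distrib_right sum.distrib)

lemma ip_diff_left:
  assumes "G \<in> carrier_mat n n" "u \<in> carrier_vec n" "w \<in> carrier_vec n" "v \<in> carrier_vec n"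
  shows "ip G (u - w) v = ip G u v - ip G w v"
  using assms unfolding ip_def by (intro minus_scalar_prod_distrib[of _ n]) auto

lemma ip_diff_right:
  assumes "G \<in> carrier_mat n n" "u \<in> carrier_vec n" "w \<in> carrier_vec n" "v \<in> carrier_vec n"
  shows "ip G v (u - w) = ip G v u - ip G v w"
  using assms unfolding ip_def
  by (simp add: mult_minus_distrib_mat_vec[of _ n n] scalar_prod_minus_distrib[of _ n])

lemma ip_pos:
  assumes "sym_pos_def n G" "u \<in> carrier_vec n" "u \<noteq> 0\<^sub>v n"
  shows "ip G u u > 0"
  using assms by (auto simp: sym_pos_def_def ip_def)

lemma ip_nonneg:
  assumes "sym_pos_def n G" "u \<in> carrier_vec n"
  shows "ip G u u \<ge> 0"
proof (cases "u = 0\<^sub>v n")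
  case True
  have "G \<in> carrier_mat n n" using assms by (auto simp: sym_pos_def_def)
  then show ?thesis using True by (simp add: ip_sum[of _ n])
qed (use ip_pos[OF assms] in simp)

text \<open>Positive definiteness makes testing against all vectors faithful: the vector to test with is
  the difference itself.\<close>

lemma ip_nondegenerate:
  assumes G: "sym_pos_def n G" and u: "u \<in> carrier_vec n" and w: "w \<in> carrier_vec n"
    and eq: "\<And>v. v \<in> carrier_vec n \<Longrightarrow> ip G v u = ip G v w"
  shows "u = w"
proof -
  have c: "G \<in> carrier_mat n n" using G by (auto simp: sym_pos_def_def)
  have "ip G (u - w) (u - w) = 0"
    using eq[of "u - w"] c u w by (simp add: ip_diff_right)
  then have "u - w = 0\<^sub>v n" using ip_pos[OF G, of "u - w"] u w by fastforce
  then have "(u - w) $ i = 0" if "i < n" for i using that by simp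
  then show ?thesis using u w by (intro eq_vecI) auto
qed

text \<open>The matrix \<open>E\<^sup>T K E\<close> is the pull-back of the inner product \<open>K\<close> along \<open>E\<close>. Both the inner product
  of the joined grid and the matrix \<open>H\<^sub>2\<close> of the boundary products arise in this way.\<close>

lemma ip_congruence:
  assumes "K \<in> carrier_mat m m" "E \<in> carrier_mat m n" "u \<in> carrier_vec n" "v \<in> carrier_vec n"
  shows "ip (transpose_mat E * K * E) u v = ip K (E *\<^sub>v u) (E *\<^sub>v v)"
proof -
  have "ip (transpose_mat E * K * E) u v = u \<bullet> (transpose_mat E *\<^sub>v (K *\<^sub>v (E *\<^sub>v v)))"
    using assms unfolding ip_def by (simp add: assoc_mult_mat_vec[of _ n m _ n] assoc_mult_mat_vec[of _ n m _ m])
  also have "\<dots> = (transpose_mat E *\<^sub>v (K *\<^sub>v (E *\<^sub>v v))) \<bullet> u"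
    using assms by (intro comm_scalar_prod[of _ n]) auto
  also have "\<dots> = (K *\<^sub>v (E *\<^sub>v v)) \<bullet> (E *\<^sub>v u)"
    using assms by (intro transpose_vec_mult_scalar[of _ m n]) auto
  also have "\<dots> = ip K (E *\<^sub>v u) (E *\<^sub>v v)"
    using assms unfolding ip_def by (intro comm_scalar_prod[of _ m]) auto
  finally show ?thesis .
qed

lemma sym_pos_def_congruence:
  assumes K: "sym_pos_def m K" and E: "E \<in> carrier_mat m n"
    and inj: "\<forall>v \<in> carrier_vec n. E *\<^sub>v v = 0\<^sub>v m \<longrightarrow> v = 0\<^sub>v n"
  shows "sym_pos_def n (transpose_mat E * K * E)"
proof -
  have c: "K \<in> carrier_mat m m" and t: "transpose_mat K = K"
    using K by (auto simp: sym_pos_def_def)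
  have "transpose_mat (transpose_mat E * K * E) = transpose_mat E * K * E"
    using c E t
    by (simp add: transpose_mult[of _ n m _ n] transpose_mult[of _ m m _ n] assoc_mult_mat[of _ n m _ m _ n])
  moreover have "x \<bullet> (transpose_mat E * K * E *\<^sub>v x) > 0" if "x \<in> carrier_vec n" "x \<noteq> 0\<^sub>v n" for x
    using ip_congruence[OF c E that(1) that(1)] ip_pos[OF K, of "E *\<^sub>v x"] inj that E
    unfolding ip_def by fastforce
  ultimately show ?thesis using c E by (auto simp: sym_pos_def_def)
qed

lemma sym_pos_def_inverse:
  assumes "sym_pos_def n G"
  shows "mat_inv G \<in> carrier_mat n n" "G * mat_inv G = 1\<^sub>m n" "mat_inv G * G = 1\<^sub>m n"
proof -
  have c: "G \<in> carrier_mat n n" using assms by (auto simp: sym_pos_def_def)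
  have "\<not> (\<exists>v. v \<in> carrier_vec n \<and> v \<noteq> 0\<^sub>v n \<and> G *\<^sub>v v = 0\<^sub>v n)"
    using assms unfolding sym_pos_def_def by fastforce
  then have "det G \<noteq> 0" by (simp add: det_0_iff_vec_prod_zero_field[OF c])
  from det_non_zero_imp_unit[OF c this, of "()"] obtain B where B: "mat_inverse G = Some B"
    using mat_inverse(1)[OF c, where b = "()"] by (cases "mat_inverse G") auto
  then show "mat_inv G \<in> carrier_mat n n" "G * mat_inv G = 1\<^sub>m n" "mat_inv G * G = 1\<^sub>m n"
    using mat_inverse(2)[OF c B] by (auto simp: mat_inv_def)
qed

lemma eq_mat_if_eq_mult_vec:
  fixes A B :: "real mat"
  assumes "A \<in> carrier_mat m n" "B \<in> carrier_mat m n"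
    and "\<And>v. v \<in> carrier_vec n \<Longrightarrow> A *\<^sub>v v = B *\<^sub>v v"
  shows "A = B"
proof (rule eq_matI)
  fix i j assume "i < dim_row B" "j < dim_col B"
  then have ij: "i < m" "j < n" using assms by auto
  have "(A *\<^sub>v unit_vec n j) $ i = (B *\<^sub>v unit_vec n j) $ i" using assms(3) by simp
  then show "A $$ (i, j) = B $$ (i, j)"
    using assms(1,2) ij by (simp add: scalar_prod_right_unit[of j n])
qed (use assms in auto)

lemma eq_mat_if_eq_ip:
  assumes "A \<in> carrier_mat n n" "B \<in> carrier_mat n n"
    and "\<And>a b. a \<in> carrier_vec n \<Longrightarrow> b \<in> carrier_vec n \<Longrightarrow> ip A a b = ip B a b"
  shows "A = B"
proof (rule eq_mat_if_eq_mult_vec[OF assms(1,2)])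
  fix v :: "real vec" assume v: "v \<in> carrier_vec n"
  have "(A *\<^sub>v v) $ i = (B *\<^sub>v v) $ i" if "i < n" for i
    using assms(3)[of "unit_vec n i" v] v that assms(1,2)
    by (simp add: ip_def scalar_prod_left_unit[of _ n] del: index_mult_mat_vec)
  then show "A *\<^sub>v v = B *\<^sub>v v" using assms(1,2) by (intro eq_vecI) auto
qed

section \<open>Weighted least-squares inverses\<close>

text \<open>Where \<open>E\<close> is injective, \<open>wpinv K E\<close> sends \<open>w\<close> to the \<open>v\<close> that minimises the distance from
  \<open>E v\<close> to \<open>w\<close> in the inner product \<open>K\<close>; the formula is the solution of the normal equations.\<close>

definition wpinv :: "real mat \<Rightarrow> real mat \<Rightarrow> real mat" where
  "wpinv K E = mat_inv (transpose_mat E * K * E) * transpose_mat E * K"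

context
  fixes K E :: "real mat" and m n :: nat
  assumes K: "sym_pos_def m K" and E: "E \<in> carrier_mat m n"
    and inj: "\<forall>v \<in> carrier_vec n. E *\<^sub>v v = 0\<^sub>v m \<longrightarrow> v = 0\<^sub>v n"
begin

lemma wpinv_gram: "sym_pos_def n (transpose_mat E * K * E)"
  by (rule sym_pos_def_congruence[OF K E inj])

lemma wpinv_carrier: "wpinv K E \<in> carrier_mat n m"
  using sym_pos_def_inverse(1)[OF wpinv_gram] K E unfolding wpinv_def sym_pos_def_def by auto

lemma wpinv_left_inverse: "wpinv K E * E = 1\<^sub>m n"
proof -
  have c: "K \<in> carrier_mat m m" using K by (auto simp: sym_pos_def_def)
  note i = sym_pos_def_inverse[OF wpinv_gram]
  have "wpinv K E * E = mat_inv (transpose_mat E * K * E) * (transpose_mat E * K * E)"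
    using i(1) c E unfolding wpinv_def
    by (simp add: assoc_mult_mat[of _ n n _ m _ n] assoc_mult_mat[of _ n n _ m _ m] assoc_mult_mat[of _ n m _ m _ n])
  then show ?thesis using i by simp
qed

text \<open>This is the normal equation \<open>E\<^sup>T K E v = E\<^sup>T K w\<close>, tested against \<open>u\<close>. It says that
  \<open>wpinv K E\<close> is the adjoint of \<open>E\<close> for the pulled-back inner product and \<open>K\<close>.\<close>

lemma ip_wpinv:
  assumes u: "u \<in> carrier_vec n" and w: "w \<in> carrier_vec m"
  shows "ip (transpose_mat E * K * E) u (wpinv K E *\<^sub>v w) = ip K (E *\<^sub>v u) w"
proof -
  let ?G = "transpose_mat E * K * E"
  have c: "K \<in> carrier_mat m m" using K by (auto simp: sym_pos_def_def)
  have g: "?G \<in> carrier_mat n n" using c E by auto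
  note i = sym_pos_def_inverse[OF wpinv_gram]
  have w1: "wpinv K E *\<^sub>v w = mat_inv ?G *\<^sub>v (transpose_mat E *\<^sub>v (K *\<^sub>v w))"
    using i(1) c E w unfolding wpinv_def
    by (simp add: assoc_mult_mat_vec[of _ n m _ m] assoc_mult_mat_vec[of _ n n _ m])
  have "?G *\<^sub>v (wpinv K E *\<^sub>v w) = (?G * mat_inv ?G) *\<^sub>v (transpose_mat E *\<^sub>v (K *\<^sub>v w))"
    unfolding w1 using i(1) g c E w by (intro assoc_mult_mat_vec[symmetric]) auto
  also have "\<dots> = transpose_mat E *\<^sub>v (K *\<^sub>v w)" using i(2) c E w by auto
  finally have "ip ?G u (wpinv K E *\<^sub>v w) = u \<bullet> (transpose_mat E *\<^sub>v (K *\<^sub>v w))" by (simp add: ip_def)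
  also have "\<dots> = (transpose_mat E *\<^sub>v (K *\<^sub>v w)) \<bullet> u"
    using c E u w by (intro comm_scalar_prod[of _ n]) auto
  also have "\<dots> = (K *\<^sub>v w) \<bullet> (E *\<^sub>v u)"
    using c E u w by (intro transpose_vec_mult_scalar[of _ m n]) auto
  also have "\<dots> = ip K (E *\<^sub>v u) w"
    using c E u w unfolding ip_def by (intro comm_scalar_prod[of _ m]) auto
  finally show ?thesis .
qed

text \<open>Both sides are the pulled-back inner product of the two least-squares solutions, which is
  symmetric.\<close>

lemma wpinv_projection_self_adjoint:
  assumes a: "a \<in> carrier_vec m" and b: "b \<in> carrier_vec m"
  shows "ip K a (E *\<^sub>v (wpinv K E *\<^sub>v b)) = ip K (E *\<^sub>v (wpinv K E *\<^sub>v a)) b"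
proof -
  let ?G = "transpose_mat E * K * E"
  have c: "K \<in> carrier_mat m m" using K by (auto simp: sym_pos_def_def)
  have pa: "wpinv K E *\<^sub>v a \<in> carrier_vec n" "wpinv K E *\<^sub>v b \<in> carrier_vec n"
    using wpinv_carrier a b by auto
  have "ip K a (E *\<^sub>v (wpinv K E *\<^sub>v b)) = ip K (E *\<^sub>v (wpinv K E *\<^sub>v b)) a"
    using E pa a by (intro ip_sym[OF K]) auto
  also have "\<dots> = ip ?G (wpinv K E *\<^sub>v b) (wpinv K E *\<^sub>v a)" by (simp add: ip_wpinv pa a)
  also have "\<dots> = ip ?G (wpinv K E *\<^sub>v a) (wpinv K E *\<^sub>v b)" by (rule ip_sym[OF wpinv_gram pa(2,1)])
  also have "\<dots> = ip K (E *\<^sub>v (wpinv K E *\<^sub>v a)) b" by (simp add: ip_wpinv pa b)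
  finally show ?thesis .
qed

lemma is_mp_inverse_wpinv: "is_mp_inverse (transpose_mat E * K * E) K E (wpinv K E)"
  unfolding is_mp_inverse_def
proof (intro conjI ballI)
  note p = wpinv_carrier and l = wpinv_left_inverse
  show "wpinv K E \<in> carrier_mat (dim_col E) (dim_row E)" using p E by auto
  show "E * wpinv K E * E = E" using assoc_mult_mat[OF E p E] l E by simp
  show "wpinv K E * E * wpinv K E = wpinv K E" using l p by simp
  fix u v
  show "ip (transpose_mat E * K * E) u ((wpinv K E * E) *\<^sub>v v)
      = ip (transpose_mat E * K * E) ((wpinv K E * E) *\<^sub>v u) v"
    if "u \<in> carrier_vec (dim_col E)" "v \<in> carrier_vec (dim_col E)"
    using that E l by simp
  show "ip K u ((E * wpinv K E) *\<^sub>v v) = ip K ((E * wpinv K E) *\<^sub>v u) v"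
    if "u \<in> carrier_vec (dim_row E)" "v \<in> carrier_vec (dim_row E)"
    using that E wpinv_projection_self_adjoint[of u v] by (simp add: assoc_mult_mat_vec[OF E p])
qed

text \<open>The description of the pseudoinverse by \<open>THE\<close> needs uniqueness. If \<open>Q\<close> is another
  pseudoinverse, injectivity of \<open>E\<close> forces \<open>Q E = 1\<close>, so that \<open>E Q\<close> and \<open>E P\<close> are projections
  with the same range, both self-adjoint. Two such projections agree:
  \<open>E Q = (E P) (E Q)\<close> has the adjoint \<open>(E Q) (E P) = E P\<close>.\<close>

lemma mp_inverse_eq_wpinv: "mp_inverse (transpose_mat E * K * E) K E = wpinv K E"
  unfolding mp_inverse_def
proof (rule the_equality, rule is_mp_inverse_wpinv)
  fix Q assume "is_mp_inverse (transpose_mat E * K * E) K E Q"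
  then have Q: "Q \<in> carrier_mat n m" and EQE: "E * Q * E = E"
    and adj: "\<And>a b. a \<in> carrier_vec m \<Longrightarrow> b \<in> carrier_vec m \<Longrightarrow>
        ip K a (E *\<^sub>v (Q *\<^sub>v b)) = ip K (E *\<^sub>v (Q *\<^sub>v a)) b"
    using E unfolding is_mp_inverse_def by (auto simp: assoc_mult_mat_vec[OF E])
  note p = wpinv_carrier
  have inj2: "v = w" if "v \<in> carrier_vec n" "w \<in> carrier_vec n" "E *\<^sub>v v = E *\<^sub>v w" for v w
  proof -
    have "E *\<^sub>v (v - w) = 0\<^sub>v m"
      using that E by (simp add: mult_minus_distrib_mat_vec[OF E])
    then have "v - w = 0\<^sub>v n" using inj that by simp
    then have "(v - w) $ i = 0" if "i < n" for i using that by simp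
    then show ?thesis using that by (intro eq_vecI) auto
  qed
  have QE: "Q *\<^sub>v (E *\<^sub>v v) = v" if v: "v \<in> carrier_vec n" for v
  proof (rule inj2)
    have Ev: "E *\<^sub>v v \<in> carrier_vec m" using E v by simp
    have "E *\<^sub>v (Q *\<^sub>v (E *\<^sub>v v)) = E * Q *\<^sub>v (E *\<^sub>v v)"
      by (rule assoc_mult_mat_vec[OF E Q Ev, symmetric])
    also have "\<dots> = E * Q * E *\<^sub>v v"
      using E Q v by (intro assoc_mult_mat_vec[symmetric]) auto
    finally show "E *\<^sub>v (Q *\<^sub>v (E *\<^sub>v v)) = E *\<^sub>v v" unfolding EQE .
  qed (use v E Q in auto)
  have PE: "wpinv K E *\<^sub>v (E *\<^sub>v v) = v" if "v \<in> carrier_vec n" for v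
    using that wpinv_left_inverse assoc_mult_mat_vec[OF p E that] by simp
  show "Q = wpinv K E"
  proof (rule eq_mat_if_eq_mult_vec[OF Q p])
    fix w :: "real vec" assume w: "w \<in> carrier_vec m"
    let ?P = "wpinv K E"
    have "E *\<^sub>v (Q *\<^sub>v w) = E *\<^sub>v (?P *\<^sub>v w)"
    proof (rule ip_nondegenerate[OF K])
      fix v :: "real vec" assume v: "v \<in> carrier_vec m"
      have "ip K v (E *\<^sub>v (Q *\<^sub>v w)) = ip K v (E *\<^sub>v (?P *\<^sub>v (E *\<^sub>v (Q *\<^sub>v w))))"
        using PE Q w by simp
      also have "\<dots> = ip K (E *\<^sub>v (Q *\<^sub>v (E *\<^sub>v (?P *\<^sub>v v)))) w"
        using wpinv_projection_self_adjoint[of v "E *\<^sub>v (Q *\<^sub>v w)"] adj[of "E *\<^sub>v (?P *\<^sub>v v)" w] v w E Q p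
        by simp
      also have "\<dots> = ip K (E *\<^sub>v (?P *\<^sub>v v)) w"
        using p v by (subst QE) auto
      also have "\<dots> = ip K v (E *\<^sub>v (?P *\<^sub>v w))"
        by (rule wpinv_projection_self_adjoint[OF v w, symmetric])
      finally show "ip K v (E *\<^sub>v (Q *\<^sub>v w)) = ip K v (E *\<^sub>v (?P *\<^sub>v w))" .
    qed (use E Q p w in auto)
    then show "Q *\<^sub>v w = ?P *\<^sub>v w" using Q p w inj2[of "Q *\<^sub>v w" "?P *\<^sub>v w"] by simp
  qed
qed

text \<open>In the pulled-back norm, \<open>wpinv K E\<close> applied to \<open>w\<close> has the length of the orthogonal
  projection of \<open>w\<close> to the range of \<open>E\<close>. The bound is Pythagoras for \<open>w\<close> and that projection.\<close>

lemma wpinv_contraction: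
  assumes w: "w \<in> carrier_vec m"
  shows "ip_norm (transpose_mat E * K * E) (wpinv K E *\<^sub>v w) \<le> ip_norm K w"
proof -
  have c: "K \<in> carrier_mat m m" using K by (auto simp: sym_pos_def_def)
  let ?q = "wpinv K E *\<^sub>v w"
  let ?a = "E *\<^sub>v ?q"
  have q: "?q \<in> carrier_vec n" and a: "?a \<in> carrier_vec m" using wpinv_carrier E w by auto
  have qq: "ip (transpose_mat E * K * E) ?q ?q = ip K ?a w" by (rule ip_wpinv[OF q w])
  have aa: "ip K ?a ?a = ip K ?a w" using qq ip_congruence[OF c E q q] by simp
  have "0 \<le> ip K (w - ?a) (w - ?a)" using w a by (intro ip_nonneg[OF K]) auto
  also have "\<dots> = ip K w w - ip K ?a w"
    using c a w aa ip_sym[OF K a w] by (simp add: ip_diff_left ip_diff_right)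
  finally show ?thesis unfolding ip_norm_def qq by simp
qed

end

section \<open>Row and column slices of Kronecker products\<close>

text \<open>Row and column of a grid function in row ordering, for a grid with \<open>m\<close> points in each row and
  \<open>n\<close> rows.\<close>

definition row_slice :: "nat \<Rightarrow> real vec \<Rightarrow> nat \<Rightarrow> real vec" where
  "row_slice m w j = vec m (\<lambda>i. w $ (j * m + i))"

definition col_slice :: "nat \<Rightarrow> nat \<Rightarrow> real vec \<Rightarrow> nat \<Rightarrow> real vec" where
  "col_slice m n w i = vec n (\<lambda>j. w $ (j * m + i))"

lemma slice_carrier [simp]:
  "row_slice m w j \<in> carrier_vec m" "col_slice m n w i \<in> carrier_vec n"
  by (auto simp: row_slice_def col_slice_def)

lemma row_order_index_less: "j < n \<Longrightarrow> i < m \<Longrightarrow> j * m + i < n * (m :: nat)"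
proof -
  assume "j < n" "i < m"
  then have "j * m + i < Suc j * m" "Suc j * m \<le> n * m"
    using mult_le_mono1[of "Suc j" n m] by simp_all
  then show ?thesis by linarith
qed

lemma sum_row_order: "(\<Sum>k<n * m. f k) = (\<Sum>j<n. \<Sum>i<m. f (j * m + i :: nat))"
  by (simp flip: sum.nat_group add: sum.atLeastLessThan_shift_0 atLeast0LessThan comp_def add.commute)

lemma row_order_index_cases:
  assumes "k < n * m"
  obtains j i where "j < n" "i < m" "k = j * m + (i :: nat)"
proof
  have "m > 0" using assms by (cases m) auto
  then show "k div m < n" "k mod m < m" "k = k div m * m + k mod m"
    using assms by (auto simp: less_mult_imp_div_less)
qed

lemma kron_carrier:
  assumes "A \<in> carrier_mat n n'" "B \<in> carrier_mat m m'"
  shows "kron A B \<in> carrier_mat (n * m) (n' * m')"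
  using assms by (auto simp: kron_def)

lemma kron_index:
  assumes "A \<in> carrier_mat n n'" "B \<in> carrier_mat m m'" "j < n" "i < m" "l < n'" "q < m'"
  shows "kron A B $$ (j * m + i, l * m' + q) = A $$ (j, l) * B $$ (i, q)"
  using assms row_order_index_less[of j n i m] row_order_index_less[of l n' q m']
  by (auto simp: kron_def)

lemma kron_mult_vec_index:
  assumes "A \<in> carrier_mat n n'" "B \<in> carrier_mat m m'" "w \<in> carrier_vec (n' * m')" "j < n" "i < m"
  shows "(kron A B *\<^sub>v w) $ (j * m + i)
    = (\<Sum>l<n'. \<Sum>q<m'. A $$ (j, l) * B $$ (i, q) * w $ (l * m' + q))"
proof -
  have "(kron A B *\<^sub>v w) $ (j * m + i) = (\<Sum>k<n' * m'. kron A B $$ (j * m + i, k) * w $ k)"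
    using kron_carrier[OF assms(1,2)] assms row_order_index_less[of j n i m]
    by (auto simp: scalar_prod_def atLeast0LessThan)
  also have "\<dots> = (\<Sum>l<n'. \<Sum>q<m'. A $$ (j, l) * B $$ (i, q) * w $ (l * m' + q))"
    unfolding sum_row_order using assms by (intro sum.cong refl) (simp add: kron_index[of _ n n' _ m m'])
  finally show ?thesis .
qed

text \<open>An operator in the inner variable acts on each row separately, one in the outer variable
  on each column.\<close>

lemma row_slice_kron_one:
  assumes "D \<in> carrier_mat m m" "w \<in> carrier_vec (n * m)" "j < n"
  shows "row_slice m (kron (1\<^sub>m n) D *\<^sub>v w) j = D *\<^sub>v row_slice m w j"
proof (rule eq_vecI)
  fix i assume "i < dim_vec (D *\<^sub>v row_slice m w j)"
  then have i: "i < m" using assms by simp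
  have "row_slice m (kron (1\<^sub>m n) D *\<^sub>v w) j $ i
      = (\<Sum>l<n. \<Sum>q<m. 1\<^sub>m n $$ (j, l) * D $$ (i, q) * w $ (l * m + q))"
    using assms i by (simp add: row_slice_def kron_mult_vec_index[of _ n n D m m])
  also have "\<dots> = (\<Sum>l<n. if l = j then \<Sum>q<m. D $$ (i, q) * w $ (l * m + q) else 0)"
    using assms by (intro sum.cong refl) auto
  also have "\<dots> = (D *\<^sub>v row_slice m w j) $ i"
    using assms i by (auto simp: row_slice_def scalar_prod_def atLeast0LessThan)
  finally show "row_slice m (kron (1\<^sub>m n) D *\<^sub>v w) j $ i = (D *\<^sub>v row_slice m w j) $ i" .
qed (use assms in \<open>auto simp: row_slice_def\<close>)

lemma col_slice_kron_one:
  assumes "E \<in> carrier_mat n n'" "w \<in> carrier_vec (n' * m)" "i < m"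
  shows "col_slice m n (kron E (1\<^sub>m m) *\<^sub>v w) i = E *\<^sub>v col_slice m n' w i"
proof (rule eq_vecI)
  fix j assume "j < dim_vec (E *\<^sub>v col_slice m n' w i)"
  then have j: "j < n" using assms by simp
  have "col_slice m n (kron E (1\<^sub>m m) *\<^sub>v w) i $ j
      = (\<Sum>l<n'. \<Sum>q<m. E $$ (j, l) * 1\<^sub>m m $$ (i, q) * w $ (l * m + q))"
    using assms j by (simp add: col_slice_def kron_mult_vec_index[of E n n' _ m m])
  also have "\<dots> = (\<Sum>l<n'. \<Sum>q<m. if q = i then E $$ (j, l) * w $ (l * m + q) else 0)"
    using assms by (intro sum.cong refl) auto
  also have "\<dots> = (\<Sum>l<n'. E $$ (j, l) * w $ (l * m + i))" using assms by simp
  also have "\<dots> = (E *\<^sub>v col_slice m n' w i) $ j"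
    using assms j by (auto simp: col_slice_def scalar_prod_def atLeast0LessThan)
  finally show "col_slice m n (kron E (1\<^sub>m m) *\<^sub>v w) i $ j = (E *\<^sub>v col_slice m n' w i) $ j" .
qed (use assms in \<open>auto simp: col_slice_def\<close>)

lemma ip_kron_sum:
  assumes "A \<in> carrier_mat n n" "B \<in> carrier_mat m m" "u \<in> carrier_vec (n * m)" "v \<in> carrier_vec (n * m)"
  shows "ip (kron A B) u v
    = (\<Sum>j<n. \<Sum>i<m. \<Sum>l<n. \<Sum>q<m. A $$ (j, l) * B $$ (i, q) * (u $ (j * m + i) * v $ (l * m + q)))"
  unfolding ip_sum[OF kron_carrier[OF assms(1,2)] assms(3,4)] sum_row_order
  using assms by (intro sum.cong refl) (simp add: kron_index[of _ n n _ m m])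

text \<open>The same quadruple sum can be grouped by pairs of rows or by pairs of columns. The first
  grouping suits operators that act along rows, the second those that act along columns.\<close>

lemma ip_kron_rows:
  assumes "A \<in> carrier_mat n n" "B \<in> carrier_mat m m" "u \<in> carrier_vec (n * m)" "v \<in> carrier_vec (n * m)"
  shows "ip (kron A B) u v = (\<Sum>j<n. \<Sum>l<n. A $$ (j, l) * ip B (row_slice m u j) (row_slice m v l))"
proof -
  have "ip (kron A B) u v
    = (\<Sum>j<n. \<Sum>l<n. \<Sum>i<m. \<Sum>q<m. A $$ (j, l) * B $$ (i, q) * (u $ (j * m + i) * v $ (l * m + q)))"
    unfolding ip_kron_sum[OF assms] by (intro sum.cong refl sum.swap)
  also have "\<dots> = (\<Sum>j<n. \<Sum>l<n. A $$ (j, l) * ip B (row_slice m u j) (row_slice m v l))"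
    by (simp add: ip_sum[OF assms(2)] row_slice_def sum_distrib_left mult.assoc)
  finally show ?thesis .
qed

lemma ip_kron_cols:
  assumes "A \<in> carrier_mat n n" "B \<in> carrier_mat m m" "u \<in> carrier_vec (n * m)" "v \<in> carrier_vec (n * m)"
  shows "ip (kron A B) u v = (\<Sum>i<m. \<Sum>q<m. B $$ (i, q) * ip A (col_slice m n u i) (col_slice m n v q))"
proof -
  have "ip (kron A B) u v
    = (\<Sum>i<m. \<Sum>j<n. \<Sum>l<n. \<Sum>q<m. A $$ (j, l) * B $$ (i, q) * (u $ (j * m + i) * v $ (l * m + q)))"
    unfolding ip_kron_sum[OF assms] by (rule sum.swap)
  also have "\<dots> = (\<Sum>i<m. \<Sum>j<n. \<Sum>q<m. \<Sum>l<n. A $$ (j, l) * B $$ (i, q) * (u $ (j * m + i) * v $ (l * m + q)))"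
    by (intro sum.cong refl sum.swap)
  also have "\<dots> = (\<Sum>i<m. \<Sum>q<m. \<Sum>j<n. \<Sum>l<n. A $$ (j, l) * B $$ (i, q) * (u $ (j * m + i) * v $ (l * m + q)))"
    by (intro sum.cong refl sum.swap)
  also have "\<dots> = (\<Sum>i<m. \<Sum>q<m. B $$ (i, q) * ip A (col_slice m n u i) (col_slice m n v q))"
    by (simp add: ip_sum[OF assms(1)] col_slice_def sum_distrib_left mult_ac)
  finally show ?thesis .
qed

section \<open>Positive definiteness of Kronecker and block diagonal matrices\<close>

text \<open>A Cholesky factorisation, obtained by completing the square in the last variable. The remaining
  form, the Schur complement \<open>B\<close>, is again positive definite: its value at \<open>x\<close> is the value of
  the full form at the extension of \<open>x\<close> that makes the completed square vanish.\<close>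

lemma pos_def_gram_factor:
  fixes A :: "nat \<Rightarrow> nat \<Rightarrow> real"
  assumes "\<And>i j. i < n \<Longrightarrow> j < n \<Longrightarrow> A i j = A j i"
    and "\<And>x. \<exists>i<n. x i \<noteq> 0 \<Longrightarrow> (\<Sum>i<n. \<Sum>j<n. A i j * (x i * x j)) > 0"
  shows "\<exists>L. \<forall>i<n. \<forall>j<n. A i j = (\<Sum>k<n. L k i * L k j)"
  using assms
proof (induction n arbitrary: A)
  case (Suc n)
  define a where "a = A n n"
  define B where "B i j = A i j - A i n * A j n / a" for i j
  define e where "e i = (if i = n then 1 else 0 :: real)" for i
  have "\<exists>i<Suc n. e i \<noteq> 0" by (intro exI[of _ n]) (simp add: e_def)
  from Suc.prems(2)[OF this] have a: "a > 0" by (simp add: a_def e_def)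
  have "\<exists>L. \<forall>i<n. \<forall>j<n. B i j = (\<Sum>k<n. L k i * L k j)"
  proof (rule Suc.IH)
    show "B i j = B j i" if "i < n" "j < n" for i j
      using Suc.prems(1)[of i j] that by (simp add: B_def mult.commute)
    fix x :: "nat \<Rightarrow> real" assume "\<exists>i<n. x i \<noteq> 0"
    define s where "s = (\<Sum>j<n. A j n * x j)"
    define y where "y i = (if i = n then - s / a else x i)" for i
    have "\<exists>i<Suc n. y i \<noteq> 0" using \<open>\<exists>i<n. x i \<noteq> 0\<close> by (auto simp: y_def)
    then have "0 < (\<Sum>i<Suc n. \<Sum>j<Suc n. A i j * (y i * y j))" by (rule Suc.prems(2))
    also have "\<dots> = (\<Sum>i<n. \<Sum>j<n. A i j * (x i * x j)) + (\<Sum>i<n. A i n * (x i * (- s / a)))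
        + ((\<Sum>j<n. A n j * ((- s / a) * x j)) + a * ((- s / a) * (- s / a)))"
      by (simp add: y_def a_def sum.distrib sum_subtractf sum_negf)
    also have "(\<Sum>j<n. A n j * ((- s / a) * x j)) = (\<Sum>i<n. A i n * (x i * (- s / a)))"
      using Suc.prems(1) by (intro sum.cong) (auto simp: mult.commute)
    also have "(\<Sum>i<n. A i n * (x i * (- s / a))) = s * (- s / a)"
      unfolding s_def sum_distrib_right by (simp add: mult.assoc)
    also have "(\<Sum>i<n. \<Sum>j<n. A i j * (x i * x j)) + s * (- s / a)
          + (s * (- s / a) + a * ((- s / a) * (- s / a)))
        = (\<Sum>i<n. \<Sum>j<n. A i j * (x i * x j)) - s * s / a"
      using a by (simp add: field_simps)
    also have "s * s / a = (\<Sum>i<n. \<Sum>j<n. A i n * A j n / a * (x i * x j))"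
      unfolding s_def sum_product sum_divide_distrib by (intro sum.cong) (auto simp: mult_ac)
    also have "(\<Sum>i<n. \<Sum>j<n. A i j * (x i * x j)) - \<dots> = (\<Sum>i<n. \<Sum>j<n. B i j * (x i * x j))"
      by (simp add: B_def left_diff_distrib sum_subtractf)
    finally show "(\<Sum>i<n. \<Sum>j<n. B i j * (x i * x j)) > 0" .
  qed
  then obtain L where L: "\<forall>i<n. \<forall>j<n. B i j = (\<Sum>k<n. L k i * L k j)" by blast
  \<comment> \<open>The last row of the factor is the completed square, the others factor the complement.\<close>
  define M where "M k i = (if k = n then A i n / sqrt a else if i = n then 0 else L k i)" for k i
  have last: "M n i * M n j = A i n * A j n / a" for i j
    using a by (simp add: M_def)
  have "A i j = (\<Sum>k<Suc n. M k i * M k j)" if ij: "i < Suc n" "j < Suc n" for i j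
  proof (cases "i = n \<or> j = n")
    case True
    then have "(\<Sum>k<n. M k i * M k j) = 0" by (intro sum.neutral) (auto simp: M_def)
    then show ?thesis
      using True a Suc.prems(1)[OF ij] by (auto simp: last a_def)
  next
    case False
    then have "(\<Sum>k<n. M k i * M k j) = B i j" using L ij by (simp add: M_def)
    then show ?thesis by (simp add: last B_def)
  qed
  then show ?case by blast
qed simp

text \<open>Writing \<open>A = L\<^sup>T L\<close> turns the quadratic form of \<open>kron A B\<close> at \<open>x\<close> into the sum of the values of
  \<open>B\<close> at the vectors \<open>y\<^sub>k\<close>, the combinations of the rows of \<open>x\<close> with coefficients from row \<open>k\<close> of
  \<open>L\<close>. Not all \<open>y\<^sub>k\<close> vanish: in a column where \<open>x\<close> is nonzero, the form \<open>A\<close> is positive and is the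
  sum of the squares of the entries of the \<open>y\<^sub>k\<close> there.\<close>

lemma sym_pos_def_kron:
  assumes A: "sym_pos_def n A" and B: "sym_pos_def m B"
  shows "sym_pos_def (n * m) (kron A B)"
proof -
  have cA: "A \<in> carrier_mat n n" and tA: "transpose_mat A = A"
    and cB: "B \<in> carrier_mat m m" and tB: "transpose_mat B = B"
    using A B by (auto simp: sym_pos_def_def)
  have sA: "A $$ (i, j) = A $$ (j, i)" if "i < n" "j < n" for i j
    using index_transpose_mat(1)[of i A j] cA that unfolding tA by simp
  have sB: "B $$ (i, j) = B $$ (j, i)" if "i < m" "j < m" for i j
    using index_transpose_mat(1)[of i B j] cB that unfolding tB by simp
  have "\<exists>L. \<forall>i<n. \<forall>j<n. A $$ (i, j) = (\<Sum>k<n. L k i * L k j)"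
  proof (rule pos_def_gram_factor[OF sA])
    fix x :: "nat \<Rightarrow> real" assume "\<exists>i<n. x i \<noteq> 0"
    then have "vec n x \<noteq> 0\<^sub>v n" by (metis index_vec index_zero_vec(1))
    then show "(\<Sum>i<n. \<Sum>j<n. A $$ (i, j) * (x i * x j)) > 0"
      using ip_pos[OF A, of "vec n x"] by (simp add: ip_sum[OF cA])
  qed
  then obtain L where L: "\<And>i j. i < n \<Longrightarrow> j < n \<Longrightarrow> A $$ (i, j) = (\<Sum>k<n. L k i * L k j)" by blast
  have "kron A B $$ (r, c) = kron A B $$ (c, r)" if rc: "r < n * m" "c < n * m" for r c
  proof -
    obtain j i where r: "j < n" "i < m" "r = j * m + i"
      using row_order_index_cases[OF rc(1)] by blast
    obtain l q where c: "l < n" "q < m" "c = l * m + q"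
      using row_order_index_cases[OF rc(2)] by blast
    show ?thesis using r c sA sB by (simp add: kron_index[OF cA cB])
  qed
  then have tK: "transpose_mat (kron A B) = kron A B"
    using kron_carrier[OF cA cB] by (intro eq_matI) auto
  have pos: "x \<bullet> (kron A B *\<^sub>v x) > 0" if x: "x \<in> carrier_vec (n * m)" "x \<noteq> 0\<^sub>v (n * m)" for x
  proof -
    define y where "y k = vec m (\<lambda>i. \<Sum>j<n. L k j * x $ (j * m + i))" for k
    have y: "y k \<in> carrier_vec m" for k by (simp add: y_def)
    have "ip (kron A B) x x
        = (\<Sum>j<n. \<Sum>l<n. \<Sum>k<n. L k j * (L k l * ip B (row_slice m x j) (row_slice m x l)))"
      unfolding ip_kron_rows[OF cA cB x(1) x(1)] by (simp add: L sum_distrib_right mult.assoc)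
    also have "\<dots> = (\<Sum>k<n. \<Sum>j<n. \<Sum>l<n. L k j * (L k l * ip B (row_slice m x j) (row_slice m x l)))"
      by (rule sum_rotate)
    also have "\<dots> = (\<Sum>k<n. ip B (y k) (y k))"
    proof (intro sum.cong refl)
      fix k
      have "ip B (y k) (y k) = (\<Sum>j<n. L k j * ip B (row_slice m x j) (y k))"
        unfolding row_slice_def by (subst y_def) (rule ip_sum_left[OF cB y])
      also have "\<dots> = (\<Sum>j<n. L k j * (\<Sum>l<n. L k l * ip B (row_slice m x j) (row_slice m x l)))"
        unfolding row_slice_def y_def by (simp add: ip_sum_right[OF B])
      finally show "(\<Sum>j<n. \<Sum>l<n. L k j * (L k l * ip B (row_slice m x j) (row_slice m x l)))
          = ip B (y k) (y k)"
        by (simp add: sum_distrib_left)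
    qed
    finally have sos: "ip (kron A B) x x = (\<Sum>k<n. ip B (y k) (y k))" .
    obtain r where r: "r < n * m" "x $ r \<noteq> 0" using x by (auto simp: vec_eq_iff)
    then obtain j i where ji: "j < n" "i < m" "x $ (j * m + i) \<noteq> 0"
      by (metis row_order_index_cases)
    let ?c = "col_slice m n x i"
    have "?c \<noteq> 0\<^sub>v n" using ji by (auto simp: col_slice_def vec_eq_iff)
    then have "0 < ip A ?c ?c" using ip_pos[OF A] by simp
    also have "\<dots> = (\<Sum>j<n. \<Sum>l<n. \<Sum>k<n. (L k j * x $ (j * m + i)) * (L k l * x $ (l * m + i)))"
      by (simp add: ip_sum[OF cA] L col_slice_def sum_distrib_left sum_distrib_right mult_ac)
    also have "\<dots> = (\<Sum>k<n. \<Sum>j<n. \<Sum>l<n. (L k j * x $ (j * m + i)) * (L k l * x $ (l * m + i)))"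
      by (rule sum_rotate)
    also have "\<dots> = (\<Sum>k<n. y k $ i * y k $ i)"
      using ji by (simp add: y_def sum_product)
    finally obtain k where k: "k < n" "y k $ i \<noteq> 0"
      by (metis (no_types, lifting) lessThan_iff less_irrefl mult_zero_left sum.neutral)
    then have "y k \<noteq> 0\<^sub>v m" using ji by auto
    then have "0 < ip B (y k) (y k)" using ip_pos[OF B y] by simp
    then have "0 < (\<Sum>k<n. ip B (y k) (y k))"
      using k ip_nonneg[OF B y] by (intro sum_pos2[of _ k]) auto
    then show ?thesis using sos by (simp add: ip_def)
  qed
  show ?thesis unfolding sym_pos_def_def using kron_carrier[OF cA cB] tK pos by auto
qed

lemma ip_diag_block_mat:
  assumes "A \<in> carrier_mat n n" "B \<in> carrier_mat m m"
    and "a \<in> carrier_vec n" "b \<in> carrier_vec m" "c \<in> carrier_vec n" "d \<in> carrier_vec m"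
  shows "ip (diag_block_mat [A, B]) (a @\<^sub>v b) (c @\<^sub>v d) = ip A a c + ip B b d"
    and "diag_block_mat [A, B] *\<^sub>v (c @\<^sub>v d) = (A *\<^sub>v c) @\<^sub>v (B *\<^sub>v d)"
proof -
  have dims: "dim_row A = n" "dim_col A = n" "dim_row B = m" "dim_col B = m" using assms by auto
  have "diag_block_mat [A, B] *\<^sub>v (c @\<^sub>v d)
      = (A *\<^sub>v c + 0\<^sub>m n m *\<^sub>v d) @\<^sub>v (0\<^sub>m m n *\<^sub>v c + B *\<^sub>v d)"
    unfolding diag_block_mat.simps(2)[of A "[B]"] diag_block_mat_singleton Let_def dims
    using assms by (intro four_block_mat_mult_vec) auto
  then show eq: "diag_block_mat [A, B] *\<^sub>v (c @\<^sub>v d) = (A *\<^sub>v c) @\<^sub>v (B *\<^sub>v d)"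
    using assms by auto
  show "ip (diag_block_mat [A, B]) (a @\<^sub>v b) (c @\<^sub>v d) = ip A a c + ip B b d"
    unfolding ip_def eq using assms by (intro scalar_prod_append) auto
qed

lemma diag_block_mat_carrier:
  assumes "A \<in> carrier_mat n n" "B \<in> carrier_mat m m"
  shows "diag_block_mat [A, B] \<in> carrier_mat (n + m) (n + m)"
  using assms by (auto simp: Let_def)

lemma sym_pos_def_diag_block_mat:
  assumes A: "sym_pos_def n A" and B: "sym_pos_def m B"
  shows "sym_pos_def (n + m) (diag_block_mat [A, B])"
proof -
  have cA: "A \<in> carrier_mat n n" and tA: "transpose_mat A = A"
    and cB: "B \<in> carrier_mat m m" and tB: "transpose_mat B = B"
    using A B by (auto simp: sym_pos_def_def)
  have eq: "diag_block_mat [A, B] = four_block_mat A (0\<^sub>m n m) (0\<^sub>m m n) B"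
    using cA cB unfolding diag_block_mat.simps(2)[of A "[B]"] diag_block_mat_singleton Let_def
    by (metis carrier_matD)
  have t: "transpose_mat (diag_block_mat [A, B]) = diag_block_mat [A, B]"
    unfolding eq using cA cB tA tB by (subst transpose_four_block_mat[of _ n n _ m _ m]) auto
  have "w \<bullet> (diag_block_mat [A, B] *\<^sub>v w) > 0" if w: "w \<in> carrier_vec (n + m)" "w \<noteq> 0\<^sub>v (n + m)" for w
  proof -
    let ?a = "vec_first w n" and ?b = "vec_last w m"
    have split: "w = ?a @\<^sub>v ?b" using w by simp
    have "?a \<noteq> 0\<^sub>v n \<or> ?b \<noteq> 0\<^sub>v m" using split w(2) by auto
    then have "ip A ?a ?a + ip B ?b ?b > 0"
      using ip_pos[OF A, of ?a] ip_pos[OF B, of ?b] ip_nonneg[OF A, of ?a] ip_nonneg[OF B, of ?b]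
      by (fastforce intro: add_pos_nonneg add_nonneg_pos)
    also have "ip A ?a ?a + ip B ?b ?b = w \<bullet> (diag_block_mat [A, B] *\<^sub>v w)"
      using ip_diag_block_mat(1)[OF cA cB, of ?a ?b ?a ?b] split by (simp add: ip_def)
    finally show ?thesis .
  qed
  then show ?thesis
    using diag_block_mat_carrier[OF cA cB] t unfolding sym_pos_def_def by blast
qed

section \<open>Summation by parts on one block\<close>

text \<open>One-dimensional summation by parts for every pair of rows leaves products of end points of
  rows. Weighted by the entries of \<open>A\<close>, they form the \<open>A\<close>-products of the last and the first
  column. The companion lemma exchanges rows and columns.\<close>

lemma kron_sbp_rows:
  assumes "A \<in> carrier_mat (n + 1) (n + 1)" "B \<in> carrier_mat (m + 1) (m + 1)" "sbp_1d m B D"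
    and "u \<in> carrier_vec ((n + 1) * (m + 1))" "v \<in> carrier_vec ((n + 1) * (m + 1))"
  defines "K \<equiv> kron (1\<^sub>m (n + 1)) D"
  shows "ip (kron A B) u (K *\<^sub>v v) + ip (kron A B) (K *\<^sub>v u) v
    = ip A (col_slice (m + 1) (n + 1) u m) (col_slice (m + 1) (n + 1) v m)
      - ip A (col_slice (m + 1) (n + 1) u 0) (col_slice (m + 1) (n + 1) v 0)"
proof -
  let ?r = "row_slice (m + 1)"
  have D: "D \<in> carrier_mat (m + 1) (m + 1)" using assms(3) by (simp add: sbp_1d_def)
  have K: "K \<in> carrier_mat ((n + 1) * (m + 1)) ((n + 1) * (m + 1))"
    unfolding K_def by (intro kron_carrier D) auto
  have Kr: "?r (K *\<^sub>v w) j = D *\<^sub>v ?r w j" if "w \<in> carrier_vec ((n + 1) * (m + 1))" "j < n + 1" for w j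
    unfolding K_def by (rule row_slice_kron_one[OF D that])
  have sbp: "ip B (?r u j) (D *\<^sub>v ?r v l) + ip B (D *\<^sub>v ?r u j) (?r v l)
      = ?r u j $ m * ?r v l $ m - ?r u j $ 0 * ?r v l $ 0" for j l
    using assms(3) slice_carrier unfolding sbp_1d_def by fastforce
  have "ip (kron A B) u (K *\<^sub>v v) + ip (kron A B) (K *\<^sub>v u) v
      = (\<Sum>j<n + 1. \<Sum>l<n + 1. A $$ (j, l) *
          (ip B (?r u j) (D *\<^sub>v ?r v l) + ip B (D *\<^sub>v ?r u j) (?r v l)))"
    using K assms(4,5)
    by (simp add: ip_kron_rows[OF assms(1,2)] Kr[simplified] distrib_left sum.distrib del: sum.lessThan_Suc)
  also have "\<dots> = ip A (col_slice (m + 1) (n + 1) u m) (col_slice (m + 1) (n + 1) v m)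
      - ip A (col_slice (m + 1) (n + 1) u 0) (col_slice (m + 1) (n + 1) v 0)"
    unfolding sbp
    by (simp add: ip_sum[OF assms(1)] row_slice_def col_slice_def right_diff_distrib sum_subtractf
        del: sum.lessThan_Suc)
  finally show ?thesis .
qed

lemma kron_sbp_cols:
  assumes "A \<in> carrier_mat (n + 1) (n + 1)" "B \<in> carrier_mat (m + 1) (m + 1)" "sbp_1d n A D"
    and "u \<in> carrier_vec ((n + 1) * (m + 1))" "v \<in> carrier_vec ((n + 1) * (m + 1))"
  defines "K \<equiv> kron D (1\<^sub>m (m + 1))"
  shows "ip (kron A B) u (K *\<^sub>v v) + ip (kron A B) (K *\<^sub>v u) v
    = ip B (row_slice (m + 1) u n) (row_slice (m + 1) v n)
      - ip B (row_slice (m + 1) u 0) (row_slice (m + 1) v 0)"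
proof -
  let ?c = "col_slice (m + 1) (n + 1)"
  have D: "D \<in> carrier_mat (n + 1) (n + 1)" using assms(3) by (simp add: sbp_1d_def)
  have K: "K \<in> carrier_mat ((n + 1) * (m + 1)) ((n + 1) * (m + 1))"
    unfolding K_def by (intro kron_carrier D) auto
  have Kc: "?c (K *\<^sub>v w) j = D *\<^sub>v ?c w j" if "w \<in> carrier_vec ((n + 1) * (m + 1))" "j < m + 1" for w j
    unfolding K_def by (rule col_slice_kron_one[OF D that])
  have sbp: "ip A (?c u i) (D *\<^sub>v ?c v q) + ip A (D *\<^sub>v ?c u i) (?c v q)
      = ?c u i $ n * ?c v q $ n - ?c u i $ 0 * ?c v q $ 0" for i q
    using assms(3) slice_carrier unfolding sbp_1d_def by fastforce
  have "ip (kron A B) u (K *\<^sub>v v) + ip (kron A B) (K *\<^sub>v u) v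
      = (\<Sum>i<m + 1. \<Sum>q<m + 1. B $$ (i, q) *
          (ip A (?c u i) (D *\<^sub>v ?c v q) + ip A (D *\<^sub>v ?c u i) (?c v q)))"
    using K assms(4,5)
    by (simp add: ip_kron_cols[OF assms(1,2)] Kc[simplified] distrib_left sum.distrib del: sum.lessThan_Suc)
  also have "\<dots> = ip B (row_slice (m + 1) u n) (row_slice (m + 1) v n)
      - ip B (row_slice (m + 1) u 0) (row_slice (m + 1) v 0)"
    unfolding sbp
    by (simp add: ip_sum[OF assms(2)] row_slice_def col_slice_def right_diff_distrib sum_subtractf
        del: sum.lessThan_Suc)
  finally show ?thesis .
qed

section \<open>The joined grid\<close>

text \<open>The index of the grid row of the joined grid at which block \<open>k\<close> begins. The interface row has
  index \<open>Ny S 1\<close> and belongs to both blocks.\<close>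

definition offset :: "two_block \<Rightarrow> nat \<Rightarrow> nat" where
  "offset S k = (if k = 1 then 0 else Ny S 1)"

definition dim_blk :: "two_block \<Rightarrow> nat \<Rightarrow> nat" where
  "dim_blk S k = (Ny S k + 1) * (Nx S + 1)"

definition blk :: "two_block \<Rightarrow> nat \<Rightarrow> real vec \<Rightarrow> real vec" where
  "blk S k v = vec (dim_blk S k) (\<lambda>r. v $ (offset S k * (Nx S + 1) + r))"

lemma blk_carrier [simp]: "blk S k v \<in> carrier_vec (dim_blk S k)"
  by (simp add: blk_def)

lemma offset_le: "k \<in> {1, 2} \<Longrightarrow> offset S k + Ny S k \<le> Ny_tot S"
  by (auto simp: offset_def Ny_tot_def)

lemma E2_carrier: "E2 S k \<in> carrier_mat (Ny S k + 1) (Ny_tot S + 1)"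
  by (simp add: E2_def)

lemma E2_mult_vec_index:
  assumes "k \<in> {1, 2}" "c \<in> carrier_vec (Ny_tot S + 1)" "j < Ny S k + 1"
  shows "(E2 S k *\<^sub>v c) $ j = c $ (offset S k + j)"
proof -
  have "(E2 S k *\<^sub>v c) $ j = (\<Sum>l<Ny_tot S + 1. E2 S k $$ (j, l) * c $ l)"
    using E2_carrier[of S k] assms(2,3) by (auto simp: scalar_prod_def atLeast0LessThan)
  also have "\<dots> = (\<Sum>l<Ny_tot S + 1. if l = offset S k + j then c $ l else 0)"
    using assms(3) unfolding E2_def offset_def by (intro sum.cong refl) simp
  also have "\<dots> = c $ (offset S k + j)" using offset_le[OF assms(1), of S] assms(3) by simp
  finally show ?thesis .
qed

lemma grid_col_eq_col_slice: "grid_col S v i = col_slice (Nx S + 1) (Ny_tot S + 1) v i"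
  by (simp add: grid_col_def col_slice_def)

lemma row_slice_blk:
  assumes "j < Ny S k + 1"
  shows "row_slice (Nx S + 1) (blk S k v) j = grid_row S v (offset S k + j)"
  using assms row_order_index_less[of j "Ny S k + 1" _ "Nx S + 1"]
  unfolding row_slice_def blk_def dim_blk_def grid_row_def
  by (intro eq_vecI) (auto simp: distrib_right add.assoc simp del: mult_Suc mult_Suc_right)

lemma col_slice_blk:
  assumes "k \<in> {1, 2}" "i < Nx S + 1"
  shows "col_slice (Nx S + 1) (Ny S k + 1) (blk S k v) i = E2 S k *\<^sub>v grid_col S v i"
proof (rule eq_vecI)
  fix j assume "j < dim_vec (E2 S k *\<^sub>v grid_col S v i)"
  then have j: "j < Ny S k + 1" by (simp add: E2_def)
  have "(E2 S k *\<^sub>v grid_col S v i) $ j = grid_col S v i $ (offset S k + j)"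
    using j by (intro E2_mult_vec_index assms(1)) (simp_all add: grid_col_def)
  also have "\<dots> = v $ ((offset S k + j) * (Nx S + 1) + i)"
    using offset_le[OF assms(1), of S] j by (simp add: grid_col_def)
  also have "\<dots> = col_slice (Nx S + 1) (Ny S k + 1) (blk S k v) i $ j"
    using j row_order_index_less[OF j assms(2)]
    by (simp add: col_slice_def blk_def dim_blk_def distrib_right add.assoc del: mult_Suc mult_Suc_right)
  finally show "col_slice (Nx S + 1) (Ny S k + 1) (blk S k v) i $ j = (E2 S k *\<^sub>v grid_col S v i) $ j" ..
qed (simp add: col_slice_def E2_def)

lemma kron_E2_mult_vec:
  assumes "k \<in> {1, 2}" "v \<in> carrier_vec (dimV S)"
  shows "kron (E2 S k) (1\<^sub>m (Nx S + 1)) *\<^sub>v v = blk S k v"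
proof (rule eq_vecI)
  let ?w = "kron (E2 S k) (1\<^sub>m (Nx S + 1)) *\<^sub>v v"
  have v: "v \<in> carrier_vec ((Ny_tot S + 1) * (Nx S + 1))" using assms(2) by (simp add: dimV_def mult.commute)
  fix r assume "r < dim_vec (blk S k v)"
  then have "r < (Ny S k + 1) * (Nx S + 1)" by (simp add: blk_def dim_blk_def)
  then obtain j i where r: "j < Ny S k + 1" "i < Nx S + 1" "r = j * (Nx S + 1) + i"
    by (rule row_order_index_cases)
  have "?w $ r = col_slice (Nx S + 1) (Ny S k + 1) ?w i $ j" using r by (simp add: col_slice_def)
  also have "\<dots> = col_slice (Nx S + 1) (Ny S k + 1) (blk S k v) i $ j"
    unfolding col_slice_kron_one[OF E2_carrier v r(2)] col_slice_blk[OF assms(1) r(2)] grid_col_eq_col_slice ..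
  also have "\<dots> = blk S k v $ r" using r by (simp add: col_slice_def)
  finally show "?w $ r = blk S k v $ r" .
qed (simp add: blk_def dim_blk_def kron_def E2_def)

lemma kron_E2_carrier: "kron (E2 S k) (1\<^sub>m (Nx S + 1)) \<in> carrier_mat (dim_blk S k) (dimV S)"
  using kron_carrier[OF E2_carrier[of S k] one_carrier_mat[of "Nx S + 1"]]
  by (simp add: dimV_def dim_blk_def mult.commute)

lemma Ey_carrier: "Ey S \<in> carrier_mat (dim_blk S 1 + dim_blk S 2) (dimV S)"
  unfolding Ey_def by (rule carrier_append_rows[OF kron_E2_carrier kron_E2_carrier])

lemma Ey_mult_vec:
  assumes "v \<in> carrier_vec (dimV S)"
  shows "Ey S *\<^sub>v v = blk S 1 v @\<^sub>v blk S 2 v"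
  unfolding Ey_def mat_mult_append[OF kron_E2_carrier kron_E2_carrier assms]
  using kron_E2_mult_vec[OF _ assms] by simp

text \<open>The two blocks cover the joined grid, which is what makes \<open>Ey\<close> injective.\<close>

lemma blk_index_cases:
  assumes "r < dimV S"
  obtains k q where "k \<in> {1, 2}" "q < dim_blk S k" "\<And>v. blk S k v $ q = v $ r"
proof (cases "r < dim_blk S 1")
  case True
  then show ?thesis by (intro that[of 1 r]) (auto simp: blk_def offset_def)
next
  case False
  define q where "q = r - Ny S 1 * (Nx S + 1)"
  have "r = offset S 2 * (Nx S + 1) + q" using False by (auto simp: q_def offset_def dim_blk_def)
  moreover have "q < dim_blk S 2"
    using assms False by (auto simp: q_def dimV_def dim_blk_def Ny_tot_def algebra_simps)
  ultimately show ?thesis by (intro that[of 2 q]) (auto simp: blk_def simp del: mult_Suc mult_Suc_right)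
qed

lemma Ey_injective:
  "\<forall>v \<in> carrier_vec (dimV S). Ey S *\<^sub>v v = 0\<^sub>v (dim_blk S 1 + dim_blk S 2) \<longrightarrow> v = 0\<^sub>v (dimV S)"
proof (intro ballI impI eq_vecI)
  fix v assume v: "v \<in> carrier_vec (dimV S)" and 0: "Ey S *\<^sub>v v = 0\<^sub>v (dim_blk S 1 + dim_blk S 2)"
  show "dim_vec v = dim_vec (0\<^sub>v (dimV S))" using v by simp
  fix r assume "r < dim_vec (0\<^sub>v (dimV S) :: real vec)"
  then have "r < dimV S" by simp
  then obtain k q where k: "k \<in> {1, 2}" "q < dim_blk S k" "\<And>v. blk S k v $ q = v $ r"
    using blk_index_cases by metis
  have "blk S 1 v @\<^sub>v blk S 2 v = 0\<^sub>v (dim_blk S 1) @\<^sub>v 0\<^sub>v (dim_blk S 2)"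
    using 0 Ey_mult_vec[OF v] by auto
  then have "blk S 1 v = 0\<^sub>v (dim_blk S 1)" "blk S 2 v = 0\<^sub>v (dim_blk S 2)"
    by (auto simp: append_vec_eq[OF blk_carrier zero_carrier_vec])
  then have "blk S k v $ q = 0" using k(1,2) by auto
  then show "v $ r = 0\<^sub>v (dimV S) $ r" using k(3) \<open>r < dimV S\<close> by simp
qed

text \<open>The common form of the two difference operators, for an arbitrary pair of block operators. All
  facts that do not depend on the direction are proved for it.\<close>

definition joined :: "two_block \<Rightarrow> (nat \<Rightarrow> real mat) \<Rightarrow> real mat" where
  "joined S D = wpinv (H_plus S) (Ey S) * diag_block_mat [D 1, D 2] * Ey S"

lemma Dx_eq_joined: "Dx S = joined S (Dx_blk S)"
  and Dy_eq_joined: "Dy S = joined S (Dy_blk S)"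
  by (simp_all add: Dx_def Dy_def joined_def wpinv_def H_mat_def Dx_plus_def Dy_plus_def)

section \<open>Joined difference operators\<close>

context
  fixes S :: two_block
  assumes valid: "valid_two_block S"
begin

lemma block_carriers:
  assumes "k \<in> {1, 2}"
  shows "normx S k \<in> carrier_mat (Nx S + 1) (Nx S + 1)"
    and "normy S k \<in> carrier_mat (Ny S k + 1) (Ny S k + 1)"
    and "H_blk S k \<in> carrier_mat (dim_blk S k) (dim_blk S k)"
  using assms valid unfolding valid_two_block_def sym_pos_def_def H_blk_def dim_blk_def
  by (auto intro!: kron_carrier simp del: mult_Suc mult_Suc_right)

lemma Dx_blk_carriers: "\<forall>k \<in> {1, 2}. Dx_blk S k \<in> carrier_mat (dim_blk S k) (dim_blk S k)"
  and Dy_blk_carriers: "\<forall>k \<in> {1, 2}. Dy_blk S k \<in> carrier_mat (dim_blk S k) (dim_blk S k)"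
  using valid unfolding valid_two_block_def sbp_1d_def Dx_blk_def Dy_blk_def dim_blk_def
  by (auto intro!: kron_carrier simp del: mult_Suc mult_Suc_right)

lemma H_blk_spd: "k \<in> {1, 2} \<Longrightarrow> sym_pos_def (dim_blk S k) (H_blk S k)"
  using valid unfolding valid_two_block_def H_blk_def dim_blk_def by (blast intro: sym_pos_def_kron)

lemma H_plus_spd: "sym_pos_def (dim_blk S 1 + dim_blk S 2) (H_plus S)"
  unfolding H_plus_def by (intro sym_pos_def_diag_block_mat H_blk_spd) auto

lemmas join = H_plus_spd Ey_carrier[of S] Ey_injective[of S]

lemma H_mat_spd: "sym_pos_def (dimV S) (H_mat S)"
  unfolding H_mat_def by (rule wpinv_gram[OF join])

lemma Ey_pinv_eq_wpinv: "Ey_pinv S = wpinv (H_plus S) (Ey S)"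
  unfolding Ey_pinv_def H_mat_def by (rule mp_inverse_eq_wpinv[OF join])

context
  fixes D :: "nat \<Rightarrow> real mat"
  assumes D_carriers: "\<forall>k \<in> {1, 2}. D k \<in> carrier_mat (dim_blk S k) (dim_blk S k)"
begin

lemmas D = bspec[OF D_carriers]

lemma joined_mult_vec:
  assumes v: "v \<in> carrier_vec (dimV S)"
  shows "joined S D *\<^sub>v v
    = wpinv (H_plus S) (Ey S) *\<^sub>v ((D 1 *\<^sub>v blk S 1 v) @\<^sub>v (D 2 *\<^sub>v blk S 2 v))"
proof -
  let ?n = "dim_blk S 1 + dim_blk S 2" and ?P = "wpinv (H_plus S) (Ey S)" and ?D = "diag_block_mat [D 1, D 2]"
  have P: "?P \<in> carrier_mat (dimV S) ?n" by (rule wpinv_carrier[OF join])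
  have D': "?D \<in> carrier_mat ?n ?n" by (intro diag_block_mat_carrier D) auto
  have Ev: "Ey S *\<^sub>v v \<in> carrier_vec ?n" using Ey_carrier v by (rule mult_mat_vec_carrier)
  have "joined S D *\<^sub>v v = (?P * ?D) *\<^sub>v (Ey S *\<^sub>v v)"
    unfolding joined_def by (rule assoc_mult_mat_vec[OF mult_carrier_mat[OF P D'] Ey_carrier v])
  also have "\<dots> = ?P *\<^sub>v (?D *\<^sub>v (Ey S *\<^sub>v v))" by (rule assoc_mult_mat_vec[OF P D' Ev])
  also have "?D *\<^sub>v (Ey S *\<^sub>v v) = (D 1 *\<^sub>v blk S 1 v) @\<^sub>v (D 2 *\<^sub>v blk S 2 v)"
    unfolding Ey_mult_vec[OF v] by (rule ip_diag_block_mat(2)[OF D D blk_carrier blk_carrier]) auto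
  finally show ?thesis .
qed

lemma D_blk_carrier: "k \<in> {1, 2} \<Longrightarrow> D k *\<^sub>v blk S k v \<in> carrier_vec (dim_blk S k)"
  using D by (rule mult_mat_vec_carrier) simp_all

lemma joined_carrier: "v \<in> carrier_vec (dimV S) \<Longrightarrow> joined S D *\<^sub>v v \<in> carrier_vec (dimV S)"
  unfolding joined_mult_vec
  by (rule mult_mat_vec_carrier[OF wpinv_carrier[OF join]]) (intro append_carrier_vec D_blk_carrier; simp)

text \<open>The least-squares inverse moves to the other argument, where it becomes \<open>Ey\<close>; on \<open>V\<^sub>+\<close> the two
  blocks decouple.\<close>

lemma ip_joined:
  assumes u: "u \<in> carrier_vec (dimV S)" and v: "v \<in> carrier_vec (dimV S)"
  shows "ip (H_mat S) u (joined S D *\<^sub>v v)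
    = ip (H_blk S 1) (blk S 1 u) (D 1 *\<^sub>v blk S 1 v) + ip (H_blk S 2) (blk S 2 u) (D 2 *\<^sub>v blk S 2 v)"
proof -
  have "ip (H_mat S) u (joined S D *\<^sub>v v)
      = ip (H_plus S) (Ey S *\<^sub>v u) ((D 1 *\<^sub>v blk S 1 v) @\<^sub>v (D 2 *\<^sub>v blk S 2 v))"
    unfolding H_mat_def joined_mult_vec[OF v]
    by (rule ip_wpinv[OF join u]) (intro append_carrier_vec D_blk_carrier; simp)
  also have "\<dots> = ip (H_blk S 1) (blk S 1 u) (D 1 *\<^sub>v blk S 1 v) + ip (H_blk S 2) (blk S 2 u) (D 2 *\<^sub>v blk S 2 v)"
    unfolding H_plus_def Ey_mult_vec[OF u]
    by (rule ip_diag_block_mat(1)) (use block_carriers(3) D_blk_carrier in auto)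
  finally show ?thesis .
qed

lemma ip_joined_left:
  assumes u: "u \<in> carrier_vec (dimV S)" and v: "v \<in> carrier_vec (dimV S)"
  shows "ip (H_mat S) (joined S D *\<^sub>v u) v
    = ip (H_blk S 1) (D 1 *\<^sub>v blk S 1 u) (blk S 1 v) + ip (H_blk S 2) (D 2 *\<^sub>v blk S 2 u) (blk S 2 v)"
  using ip_sym[OF H_mat_spd joined_carrier[OF u] v] ip_joined[OF v u]
    ip_sym[OF H_blk_spd[of 1] blk_carrier D_blk_carrier[of 1], of v u]
    ip_sym[OF H_blk_spd[of 2] blk_carrier D_blk_carrier[of 2], of v u]
  by simp

text \<open>A left inverse of \<open>Ey\<close> recovers \<open>r'\<close> from its two block restrictions, so the error is
  the image of the pair of block errors under a map that does not increase norms.\<close>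

lemma joined_error_bound:
  assumes r: "r \<in> carrier_vec (dimV S)" and r': "r' \<in> carrier_vec (dimV S)"
  shows "ip_norm (H_mat S) (joined S D *\<^sub>v r - r')
    \<le> ip_norm (H_blk S 1) (D 1 *\<^sub>v blk S 1 r - blk S 1 r')
      + ip_norm (H_blk S 2) (D 2 *\<^sub>v blk S 2 r - blk S 2 r')"
proof -
  let ?n = "dim_blk S 1 + dim_blk S 2" and ?P = "wpinv (H_plus S) (Ey S)"
  let ?e1 = "D 1 *\<^sub>v blk S 1 r - blk S 1 r'" and ?e2 = "D 2 *\<^sub>v blk S 2 r - blk S 2 r'"
  let ?w = "(D 1 *\<^sub>v blk S 1 r) @\<^sub>v (D 2 *\<^sub>v blk S 2 r)"
  have P: "?P \<in> carrier_mat (dimV S) ?n" by (rule wpinv_carrier[OF join])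
  have c: "D k *\<^sub>v blk S k r \<in> carrier_vec (dim_blk S k)" if "k \<in> {1, 2}" for k
    using that by (rule D_blk_carrier)
  have w: "?w \<in> carrier_vec ?n" by (intro append_carrier_vec c) auto
  have Er: "Ey S *\<^sub>v r' \<in> carrier_vec ?n" using Ey_carrier r' by (rule mult_mat_vec_carrier)
  have e: "?e1 \<in> carrier_vec (dim_blk S 1)" "?e2 \<in> carrier_vec (dim_blk S 2)"
    by (intro minus_carrier_vec c blk_carrier; simp)+
  have "r' = ?P *\<^sub>v (Ey S *\<^sub>v r')"
    using assoc_mult_mat_vec[OF P Ey_carrier r'] wpinv_left_inverse[OF join] r' by simp
  then have "joined S D *\<^sub>v r - r' = ?P *\<^sub>v ?w - ?P *\<^sub>v (Ey S *\<^sub>v r')"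
    using joined_mult_vec[OF r] by simp
  also have "\<dots> = ?P *\<^sub>v (?w - Ey S *\<^sub>v r')"
    by (rule mult_minus_distrib_mat_vec[OF P w Er, symmetric])
  also have "?w - Ey S *\<^sub>v r' = ?e1 @\<^sub>v ?e2"
    unfolding Ey_mult_vec[OF r'] using D[of 1] D[of 2]
    by (intro eq_vecI) (auto simp: blk_def)
  finally have "ip_norm (H_mat S) (joined S D *\<^sub>v r - r') \<le> ip_norm (H_plus S) (?e1 @\<^sub>v ?e2)"
    unfolding H_mat_def using wpinv_contraction[OF join append_carrier_vec[OF e]] by simp
  also have "\<dots> = sqrt (ip (H_blk S 1) ?e1 ?e1 + ip (H_blk S 2) ?e2 ?e2)"
    unfolding ip_norm_def H_plus_def
    using ip_diag_block_mat(1)[OF block_carriers(3) block_carriers(3) e e] by simp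
  also have "\<dots> \<le> ip_norm (H_blk S 1) ?e1 + ip_norm (H_blk S 2) ?e2"
    unfolding ip_norm_def
    by (intro sqrt_add_le_add_sqrt ip_nonneg[OF H_blk_spd] e) auto
  finally show ?thesis .
qed

end

section \<open>Summation by parts on the joined grid\<close>

text \<open>The block boundary terms carry the weights \<open>H\<^sub>2\<^sup>(\<^sup>k\<^sup>)\<close>, pulled back to columns of the joined
  grid, and their sum is \<open>H\<^sub>2\<close>: both blocks meet the sides \<open>x = 0\<close> and \<open>x = 1\<close>, so no terms have to
  cancel.\<close>

lemma sbp_Dx:
  assumes u: "u \<in> carrier_vec (dimV S)" and v: "v \<in> carrier_vec (dimV S)"
  shows "ip (H_mat S) u (Dx S *\<^sub>v v) + ip (H_mat S) (Dx S *\<^sub>v u) v = bprod2 S u v - bprod4 S u v"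
proof -
  let ?c = "grid_col S"
  let ?b = "\<lambda>k i. ip (normy S k) (E2 S k *\<^sub>v ?c u i) (E2 S k *\<^sub>v ?c v i)"
  have blk: "ip (H_blk S k) (blk S k u) (Dx_blk S k *\<^sub>v blk S k v)
      + ip (H_blk S k) (Dx_blk S k *\<^sub>v blk S k u) (blk S k v) = ?b k (Nx S) - ?b k 0"
    if k: "k \<in> {1, 2}" for k
  proof -
    have "sbp_1d (Nx S) (normx S k) (diffx S k)" using valid k by (auto simp: valid_two_block_def)
    from kron_sbp_rows[OF block_carriers(2,1)[OF k] this blk_carrier[of S k u, unfolded dim_blk_def] blk_carrier[of S k v, unfolded dim_blk_def]]
    show ?thesis unfolding H_blk_def Dx_blk_def using col_slice_blk[OF k] by simp
  qed
  have H2: "ip (H2_mat S) (?c u i) (?c v i) = ?b 1 i + ?b 2 i" for i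
  proof -
    let ?A = "\<lambda>k. transpose_mat (E2 S k) * normy S k * E2 S k"
    have c: "?c w i \<in> carrier_vec (Ny_tot S + 1)" for w by (simp add: grid_col_def)
    have A: "?A k \<in> carrier_mat (Ny_tot S + 1) (Ny_tot S + 1)" if "k \<in> {1, 2}" for k
      using E2_carrier[of S k] block_carriers(2)[OF that] by auto
    have "ip (H2_mat S) (?c u i) (?c v i) = ip (?A 1) (?c u i) (?c v i) + ip (?A 2) (?c u i) (?c v i)"
      unfolding H2_mat_def by (intro ip_add_mat[OF A A c c]) auto
    also have "\<dots> = ?b 1 i + ?b 2 i"
      using ip_congruence[OF block_carriers(2)[of 1] E2_carrier c c]
        ip_congruence[OF block_carriers(2)[of 2] E2_carrier c c] by simp
    finally show ?thesis .
  qed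
  show ?thesis
    unfolding bprod2_def bprod4_def H2 Dx_eq_joined
    using blk[of 1] blk[of 2] ip_joined[OF Dx_blk_carriers u v] ip_joined_left[OF Dx_blk_carriers u v]
    by simp
qed

text \<open>The last bracket is the contribution of the interface, which each block sees as a part of its
  own boundary with the outer normal pointing the other way.\<close>

lemma sbp_Dy:
  assumes u: "u \<in> carrier_vec (dimV S)" and v: "v \<in> carrier_vec (dimV S)"
  defines "b \<equiv> \<lambda>k j. ip (normx S k) (grid_row S u j) (grid_row S v j)"
  shows "ip (H_mat S) u (Dy S *\<^sub>v v) + ip (H_mat S) (Dy S *\<^sub>v u) v
    = (b 2 (Ny_tot S) - b 1 0) + (b 1 (Ny S 1) - b 2 (Ny S 1))"
proof -
  have blk: "ip (H_blk S k) (blk S k u) (Dy_blk S k *\<^sub>v blk S k v)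
      + ip (H_blk S k) (Dy_blk S k *\<^sub>v blk S k u) (blk S k v)
      = b k (offset S k + Ny S k) - b k (offset S k)"
    if k: "k \<in> {1, 2}" for k
  proof -
    have "sbp_1d (Ny S k) (normy S k) (diffy S k)" using valid k by (auto simp: valid_two_block_def)
    from kron_sbp_cols[OF block_carriers(2,1)[OF k] this blk_carrier[of S k u, unfolded dim_blk_def] blk_carrier[of S k v, unfolded dim_blk_def]]
    show ?thesis unfolding H_blk_def Dy_blk_def b_def using row_slice_blk[of _ S k] by simp
  qed
  show ?thesis
    unfolding Dy_eq_joined
    using blk[of 1] blk[of 2] ip_joined[OF Dy_blk_carriers u v] ip_joined_left[OF Dy_blk_carriers u v]
    by (simp add: offset_def Ny_tot_def)
qed

text \<open>For the converse, a grid function supported in the bottom row sees only \<open>normx S 1\<close> in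
  \<open>sbp_Dy\<close>, and one supported in the top row only \<open>normx S 2\<close>. This uses that both blocks have
  at least two rows of points, so that neither of these rows is the interface.\<close>

lemma sbp_2d_iff:
  assumes H1: "sym_pos_def (Nx S + 1) H1"
  shows "sbp_2d S H1 \<longleftrightarrow> normx S 1 = H1 \<and> normx S 2 = H1"
proof
  assume eq: "normx S 1 = H1 \<and> normx S 2 = H1"
  show "sbp_2d S H1"
    unfolding sbp_2d_def bprod1_def bprod3_def
    using sbp_Dx sbp_Dy eq by (fastforce simp: algebra_simps)
next
  assume sbp: "sbp_2d S H1"
  have c: "H1 \<in> carrier_mat (Nx S + 1) (Nx S + 1)" using H1 by (simp add: sym_pos_def_def)
  have pos: "Ny S 1 > 0" "Ny S 2 > 0" using valid by (auto simp: valid_two_block_def)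
  \<comment> \<open>\<open>s j a\<close> has the values \<open>a\<close> in row \<open>j\<close> and vanishes elsewhere.\<close>
  define s where "s j a = vec (dimV S)
    (\<lambda>r. if r div (Nx S + 1) = j then a $ (r mod (Nx S + 1)) else 0 :: real)" for j a
  have s: "s j a \<in> carrier_vec (dimV S)" for j a by (simp add: s_def)
  have row: "grid_row S (s j a) l = (if l = j then a else 0\<^sub>v (Nx S + 1))"
    if "a \<in> carrier_vec (Nx S + 1)" "l \<le> Ny_tot S" for j a l
  proof (rule eq_vecI)
    fix i assume "i < dim_vec (if l = j then a else 0\<^sub>v (Nx S + 1))"
    then have i: "i < Nx S + 1" using that by (auto split: if_splits)
    then have "l * (Nx S + 1) + i < dimV S"
      using that row_order_index_less[of l "Ny_tot S + 1" i "Nx S + 1"] by (simp add: dimV_def mult.commute)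
    moreover have "(l * (Nx S + 1) + i) div (Nx S + 1) = l" "(l * (Nx S + 1) + i) mod (Nx S + 1) = i"
      using i by (simp_all del: mult_Suc_right mult_Suc)
    ultimately show "grid_row S (s j a) l $ i = (if l = j then a else 0\<^sub>v (Nx S + 1)) $ i"
      using i by (simp add: grid_row_def s_def del: mult_Suc_right mult_Suc)
  qed (use that in \<open>auto simp: grid_row_def\<close>)
  have zero: "ip G (0\<^sub>v (Nx S + 1)) (0\<^sub>v (Nx S + 1)) = 0"
    if "G \<in> carrier_mat (Nx S + 1) (Nx S + 1)" for G
    using that by (simp add: ip_sum)
  have key: "bprod3 S H1 (s j a) (s j b) - bprod1 S H1 (s j a) (s j b)
      = ip (normx S 2) (grid_row S (s j a) (Ny_tot S)) (grid_row S (s j b) (Ny_tot S))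
        - ip (normx S 1) (grid_row S (s j a) 0) (grid_row S (s j b) 0)
        + (ip (normx S 1) (grid_row S (s j a) (Ny S 1)) (grid_row S (s j b) (Ny S 1))
          - ip (normx S 2) (grid_row S (s j a) (Ny S 1)) (grid_row S (s j b) (Ny S 1)))" for j a b
    using sbp sbp_Dy[OF s s, of j a j b] s unfolding sbp_2d_def by fastforce
  note zeros = zero[OF c] zero[OF block_carriers(1)[of 1]] zero[OF block_carriers(1)[of 2]]
  have "normx S 1 = H1"
  proof (rule eq_mat_if_eq_ip[OF _ c])
    fix a b :: "real vec" assume "a \<in> carrier_vec (Nx S + 1)" "b \<in> carrier_vec (Nx S + 1)"
    then show "ip (normx S 1) a b = ip H1 a b"
      using key[of 0 a b] pos zeros by (simp add: row bprod1_def bprod3_def Ny_tot_def)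
  qed (rule block_carriers(1), simp)
  moreover have "normx S 2 = H1"
  proof (rule eq_mat_if_eq_ip[OF _ c])
    fix a b :: "real vec" assume "a \<in> carrier_vec (Nx S + 1)" "b \<in> carrier_vec (Nx S + 1)"
    then show "ip (normx S 2) a b = ip H1 a b"
      using key[of "Ny_tot S" a b] pos zeros by (simp add: row bprod1_def bprod3_def Ny_tot_def)
  qed (rule block_carriers(1), simp)
  ultimately show "normx S 1 = H1 \<and> normx S 2 = H1" ..
qed

section \<open>Consistency and the main result\<close>

text \<open>The joined grid uses the coordinates of the first block along the interface; the two
  parametrisations agree there since the last point of the first block has \<open>y = 1 / 2\<close>.\<close>

lemma blk_restr:
  assumes "k \<in> {1, 2}"
  shows "blk S k (restr S f) = restr_blk S k f"
proof (rule eq_vecI)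
  fix r assume "r < dim_vec (restr_blk S k f)"
  then have "r < (Ny S k + 1) * (Nx S + 1)" by (simp add: restr_blk_def mult.commute)
  then obtain j i where r: "j < Ny S k + 1" "i < Nx S + 1" "r = j * (Nx S + 1) + i"
    by (rule row_order_index_cases)
  have pos: "Ny S 1 > 0" using valid by (auto simp: valid_two_block_def)
  have y: "y_full S (offset S k + j) = y_blk S k j"
    using assms r(1) pos by (auto simp: offset_def y_full_def y_blk_def hy_def)
  have "offset S k + j < Ny_tot S + 1" using offset_le[OF assms, of S] r(1) by simp
  from row_order_index_less[OF this r(2)]
  have less: "(offset S k + j) * (Nx S + 1) + i < dimV S" by (simp add: dimV_def mult.commute)
  have dm: "(l * (Nx S + 1) + i) div (Nx S + 1) = l" "(l * (Nx S + 1) + i) mod (Nx S + 1) = i" for l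
    using r(2) by (simp_all del: mult_Suc_right mult_Suc)
  have "blk S k (restr S f) $ r = restr S f $ ((offset S k + j) * (Nx S + 1) + i)"
    using row_order_index_less[OF r(1,2)] unfolding r(3) blk_def dim_blk_def
    by (simp add: distrib_right add.assoc del: mult_Suc_right mult_Suc)
  also have "\<dots> = f (real i * hx S) (y_full S (offset S k + j))"
    unfolding restr_def index_vec[OF less] dm ..
  also have "\<dots> = restr_blk S k f $ r"
    using row_order_index_less[OF r(1,2)] unfolding r(3) restr_blk_def y
    by (subst index_vec) (simp_all only: dm mult.commute)
  finally show "blk S k (restr S f) $ r = restr_blk S k f $ r" .
qed (simp add: blk_def dim_blk_def restr_blk_def)

end

lemma joined_consistent:
  fixes S :: "'i \<Rightarrow> two_block" and D :: "'i \<Rightarrow> nat \<Rightarrow> real mat"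
  assumes valid: "\<And>i. valid_two_block (S i)"
    and D: "\<And>i. \<forall>k \<in> {1, 2}. D i k \<in> carrier_mat (dim_blk (S i) k) (dim_blk (S i) k)"
    and O: "\<And>k. k \<in> {1, 2} \<Longrightarrow>
      (\<lambda>i. ip_norm (H_blk (S i) k) (D i k *\<^sub>v restr_blk (S i) k f - restr_blk (S i) k f')) \<in> O[F](g)"
  shows "(\<lambda>i. ip_norm (H_mat (S i)) (joined (S i) (D i) *\<^sub>v restr (S i) f - restr (S i) f')) \<in> O[F](g)"
proof -
  let ?e = "\<lambda>k i. ip_norm (H_blk (S i) k) (D i k *\<^sub>v restr_blk (S i) k f - restr_blk (S i) k f')"
  let ?E = "\<lambda>i. ip_norm (H_mat (S i)) (joined (S i) (D i) *\<^sub>v restr (S i) f - restr (S i) f')"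
  have "(\<lambda>i. ?e 1 i + ?e 2 i) \<in> O[F](g)" by (intro sum_in_bigo O) auto
  moreover have "norm (?E i) \<le> norm (?e 1 i + ?e 2 i)" for i
  proof -
    have c: "restr (S i) h \<in> carrier_vec (dimV (S i))" for h by (simp add: restr_def)
    have "joined (S i) (D i) *\<^sub>v restr (S i) f - restr (S i) f' \<in> carrier_vec (dimV (S i))"
      using joined_carrier[OF valid D c] c by simp
    then have "0 \<le> ?E i" using ip_nonneg[OF H_mat_spd[OF valid]] by (simp add: ip_norm_def)
    moreover have "?E i \<le> ?e 1 i + ?e 2 i"
      using joined_error_bound[OF valid D c[of f] c[of f']] blk_restr[OF valid] by simp
    ultimately show ?thesis by simp
  qed
  then have "?E \<in> O[F](\<lambda>i. ?e 1 i + ?e 2 i)" by (intro landau_o.big_mono) simp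
  ultimately show ?thesis by (rule landau_o.big_trans[rotated])
qed

theorem proposition88:
  fixes S :: "'i \<Rightarrow> two_block" and H1 :: "'i \<Rightarrow> real mat" and p :: real
  assumes "\<And>i. valid_two_block (S i)"
    and "\<And>i. sym_pos_def (Nx (S i) + 1) (H1 i)"
    and "p > 0"
    and "blocks_consistent p S"
  shows "(\<forall>i. sbp_2d (S i) (H1 i) \<longleftrightarrow> normx (S i) 1 = H1 i \<and> normx (S i) 2 = H1 i) \<and>
    (Dx_consistent p S \<and> Dy_consistent p S) \<and>
    (\<forall>i. Dx (S i) = Ey_pinv (S i) * Dx_plus (S i) * Ey (S i) \<and>
         Dy (S i) = Ey_pinv (S i) * Dy_plus (S i) * Ey (S i))"
proof (intro conjI allI)
  fix i
  show "sbp_2d (S i) (H1 i) \<longleftrightarrow> normx (S i) 1 = H1 i \<and> normx (S i) 2 = H1 i"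
    by (rule sbp_2d_iff[OF assms(1,2)])
  show "Dx (S i) = Ey_pinv (S i) * Dx_plus (S i) * Ey (S i)"
    "Dy (S i) = Ey_pinv (S i) * Dy_plus (S i) * Ey (S i)"
    unfolding Ey_pinv_eq_wpinv[OF assms(1)] Dx_eq_joined Dy_eq_joined joined_def Dx_plus_def Dy_plus_def
    by (rule refl)+
next
  show "Dx_consistent p S" unfolding Dx_consistent_def Dx_eq_joined
    using assms(4) unfolding blocks_consistent_def
    by (intro allI impI joined_consistent assms(1) Dx_blk_carriers Dy_blk_carriers) blast+
  show "Dy_consistent p S" unfolding Dy_consistent_def Dy_eq_joined
    using assms(4) unfolding blocks_consistent_def
    by (intro allI impI joined_consistent assms(1) Dx_blk_carriers Dy_blk_carriers) blast+
qed

end
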